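(* Let $X$ and $Y$ be complex Banach spaces. The correspondence $f\mapsto f^t$ is an isometric isomorphism from $\mathcal{H}L_0(B_X,Y)$ onto $\mathcal{L}((Y^*,w^* );(\mathcal{H}L_0(B_X),w^* ))$, the space of all weak*-to-weak* continuous linear operators from $Y^*$ into $\mathcal{H}L_0(B_X)$, endowed with the operator norm.
   Context: $B_X$ is the open unit ball of $X$. $\mathcal{H}L_0(B_X,Y)$ is the Banach space of all holomorphic Lipschitz maps $f:B_X\to Y$ with $f(0)=0$, with norm $L(f)=\sup\{\|f(x)-f(y)\|/\|x-y\|: x,y\in B_X,\ x\ne y\}$; $\mathcal{H}L_0(B_X)=\mathcal{H}L_0(B_X,\mathbb{C})$. For $f\in\mathcal{H}L_0(B_X,Y)$, its transpose is $f^t:Y^*\to\mathcal{H}L_0(B_X)$, $f^t(y^* )=y^*\circ f$. Let $\delta_X(x)(g)=g(x)$ for $x\in B_X$, $g\in\mathcal{H}L_0(B_X)$, and let $\mathcal{G}_0(B_X)=\overline{\mathrm{lin}}(\delta_X(B_X))\subseteq\mathcal{H}L_0(B_X)^*$. It is known that $\delta_X\in\mathcal{H}L_0(B_X,\mathcal{G}_0(B_X))$ and that for each $f\in\mathcal{H}L_0(B_X,Y)$ there is a unique $T_f\in\mathcal{L}(\mathcal{G}_0(B_X),Y)$ with $T_f\circ\delta_X=f$, the map $f\mapsto T_f$ being an isometric isomorphism onto $\mathcal{L}(\mathcal{G}_0(B_X),Y)$. In particular $\Lambda_X:g\mapsto T_g$ is an isometric isomorphism from $\mathcal{H}L_0(B_X)$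 onto $\mathcal{G}_0(B_X)^*$; the weak* topology of $\mathcal{H}L_0(B_X)$ is the one transported from $\mathcal{G}_0(B_X)^*$ by $\Lambda_X$. *)

theory Defs
  imports "HOL-Analysis.Analysis"
begin

section \<open>Complex normed spaces and bounded complex-linear operators\<close>

class complex_normed_vector = real_normed_vector +
  fixes scaleC :: "complex \<Rightarrow> 'a \<Rightarrow> 'a"  (infixr "*\<^sub>C" 75)
  assumes scaleC_add_right: "a *\<^sub>C (x + y) = a *\<^sub>C x + a *\<^sub>C y"
    and scaleC_add_left: "(a + b) *\<^sub>C x = a *\<^sub>C x + b *\<^sub>C x"
    and scaleC_scaleC: "a *\<^sub>C (b *\<^sub>C x) = (a * b) *\<^sub>C x"
    and scaleR_scaleC: "r *\<^sub>R x = complex_of_real r *\<^sub>C x"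
    and norm_scaleC: "norm (a *\<^sub>C x) = cmod a * norm x"

class complex_banach = complex_normed_vector + banach

instantiation complex :: complex_banach
begin
definition scaleC_complex :: "complex \<Rightarrow> complex \<Rightarrow> complex" where
  "scaleC_complex a x = a * x"
instance
  by standard (simp_all add: scaleC_complex_def algebra_simps scaleR_conv_of_real norm_mult)
end

lemma scaleC_one [simp]: "1 *\<^sub>C (x :: 'a::complex_normed_vector) = x"
  using scaleR_scaleC [of 1 x] by simp

interpretation complex_vector:
  vector_space "scaleC :: complex \<Rightarrow> 'a \<Rightarrow> 'a::complex_normed_vector"
  by unfold_locales (simp_all add: scaleC_add_right scaleC_add_left scaleC_scaleC)

definition clinear :: "('a::complex_normed_vector \<Rightarrow> 'b::complex_normed_vector) \<Rightarrow> bool" where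
  "clinear = Vector_Spaces.linear scaleC scaleC"

lemma clinear_iff:
  "clinear f \<longleftrightarrow> (\<forall>x y. f (x + y) = f x + f y) \<and> (\<forall>a x. f (a *\<^sub>C x) = a *\<^sub>C f x)"
  by (simp add: clinear_def Vector_Spaces.linear_iff complex_vector.vector_space_axioms)

definition bounded_clinear :: "('a::complex_normed_vector \<Rightarrow> 'b::complex_normed_vector) \<Rightarrow> bool" where
  "bounded_clinear f \<longleftrightarrow> clinear f \<and> bounded_linear f"

lemma bounded_clinearI:
  assumes "\<And>x y. f (x + y) = f x + f y" "\<And>a x. f (a *\<^sub>C x) = a *\<^sub>C f x"
    and "\<And>x. norm (f x) \<le> norm x * K"
  shows "bounded_clinear f"
  unfolding bounded_clinear_def clinear_iff
  using assms by (auto intro!: bounded_linear_intro [where K = K] simp: scaleR_scaleC)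

lemma bounded_clinear_add_app: "bounded_clinear f \<Longrightarrow> f (x + y) = f x + f y"
  by (simp add: bounded_clinear_def clinear_iff)

lemma bounded_clinear_scale_app: "bounded_clinear f \<Longrightarrow> f (a *\<^sub>C x) = a *\<^sub>C f x"
  by (simp add: bounded_clinear_def clinear_iff)

lemma bounded_clinear_scaleC: "bounded_clinear (\<lambda>x. a *\<^sub>C x)"
  by (rule bounded_clinearI [where K = "cmod a"])
    (simp_all add: scaleC_add_right scaleC_scaleC norm_scaleC mult.commute)

lemma bounded_clinear_compose:
  "bounded_clinear f \<Longrightarrow> bounded_clinear g \<Longrightarrow> bounded_clinear (\<lambda>x. f (g x))"
  by (auto simp: bounded_clinear_def clinear_iff intro: bounded_linear_compose)

lemma bounded_clinear_add:
  "bounded_clinear f \<Longrightarrow> bounded_clinear g \<Longrightarrow> bounded_clinear (\<lambda>x. f x + g x)"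
  by (auto simp: bounded_clinear_def clinear_iff scaleC_add_right intro: bounded_linear_add)

lemma bounded_clinear_zero: "bounded_clinear (\<lambda>x. 0)"
  by (simp add: bounded_clinear_def clinear_iff)

lemma scaleC_minus_one [simp]: "(- 1) *\<^sub>C x = - (x :: 'a::complex_normed_vector)"
  using scaleR_scaleC [of "- 1" x] by simp

lemma bounded_clinear_uminus: "bounded_clinear f \<Longrightarrow> bounded_clinear (\<lambda>x. - f x)"
  using bounded_clinear_compose [OF bounded_clinear_scaleC, of f "- 1"] by simp

lemma bounded_clinear_diff:
  "bounded_clinear f \<Longrightarrow> bounded_clinear g \<Longrightarrow> bounded_clinear (\<lambda>x. f x - g x)"
  using bounded_clinear_add [OF _ bounded_clinear_uminus, of f g] by simp

lemma bounded_clinear_scale: "bounded_clinear f \<Longrightarrow> bounded_clinear (\<lambda>x. a *\<^sub>C f x)"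
  by (rule bounded_clinear_compose [OF bounded_clinear_scaleC])

lemma bounded_clinear_scaleR: "bounded_clinear f \<Longrightarrow> bounded_clinear (\<lambda>x. r *\<^sub>R f x)"
  by (simp add: scaleR_scaleC bounded_clinear_scale)

typedef (overloaded) ('a, 'b) cblinfun =
  "{f :: 'a::complex_normed_vector \<Rightarrow> 'b::complex_normed_vector. bounded_clinear f}"
  morphisms cblinfun_apply CBlinfun
  using bounded_clinear_zero by blast

setup_lifting type_definition_cblinfun

instantiation cblinfun :: (complex_normed_vector, complex_normed_vector) complex_normed_vector
begin

lift_definition zero_cblinfun :: "('a, 'b) cblinfun" is "\<lambda>x. 0"
  by (rule bounded_clinear_zero)
lift_definition plus_cblinfun :: "('a, 'b) cblinfun \<Rightarrow> ('a, 'b) cblinfun \<Rightarrow> ('a, 'b) cblinfun"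
  is "\<lambda>f g x. f x + g x" by (rule bounded_clinear_add)
lift_definition minus_cblinfun :: "('a, 'b) cblinfun \<Rightarrow> ('a, 'b) cblinfun \<Rightarrow> ('a, 'b) cblinfun"
  is "\<lambda>f g x. f x - g x" by (rule bounded_clinear_diff)
lift_definition uminus_cblinfun :: "('a, 'b) cblinfun \<Rightarrow> ('a, 'b) cblinfun"
  is "\<lambda>f x. - f x" by (rule bounded_clinear_uminus)
lift_definition scaleR_cblinfun :: "real \<Rightarrow> ('a, 'b) cblinfun \<Rightarrow> ('a, 'b) cblinfun"
  is "\<lambda>r f x. r *\<^sub>R f x" by (rule bounded_clinear_scaleR)
lift_definition scaleC_cblinfun :: "complex \<Rightarrow> ('a, 'b) cblinfun \<Rightarrow> ('a, 'b) cblinfun"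
  is "\<lambda>a f x. a *\<^sub>C f x" by (rule bounded_clinear_scale)
lift_definition norm_cblinfun :: "('a, 'b) cblinfun \<Rightarrow> real" is onorm .

definition dist_cblinfun :: "('a, 'b) cblinfun \<Rightarrow> ('a, 'b) cblinfun \<Rightarrow> real" where
  "dist_cblinfun f g = norm (f - g)"
definition sgn_cblinfun :: "('a, 'b) cblinfun \<Rightarrow> ('a, 'b) cblinfun" where
  "sgn_cblinfun f = inverse (norm f) *\<^sub>R f"
definition uniformity_cblinfun :: "(('a, 'b) cblinfun \<times> ('a, 'b) cblinfun) filter" where
  "uniformity_cblinfun = (INF e\<in>{0 <..}. principal {(f, g). dist f g < e})"
definition open_cblinfun :: "('a, 'b) cblinfun set \<Rightarrow> bool" where
  "open_cblinfun S = (\<forall>x\<in>S. \<forall>\<^sub>F (x', y) in uniformity. x' = x \<longrightarrow> y \<in> S)"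

instance
proof
  fix f g h :: "('a, 'b) cblinfun" and r s :: real and a b :: complex and S :: "('a, 'b) cblinfun set"
  show "f + g + h = f + (g + h)" "f + g = g + f" "0 + f = f" "- f + f = 0" "f - g = f + - g"
    "r *\<^sub>R (f + g) = r *\<^sub>R f + r *\<^sub>R g" "(r + s) *\<^sub>R f = r *\<^sub>R f + s *\<^sub>R f"
    "r *\<^sub>R s *\<^sub>R f = (r * s) *\<^sub>R f" "1 *\<^sub>R f = f"
    by (transfer; simp add: algebra_simps)+
  show "a *\<^sub>C (f + g) = a *\<^sub>C f + a *\<^sub>C g" "(a + b) *\<^sub>C f = a *\<^sub>C f + b *\<^sub>C f"
    "a *\<^sub>C b *\<^sub>C f = (a * b) *\<^sub>C f"
    by (transfer; simp add: scaleC_add_left scaleC_add_right scaleC_scaleC)+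
  show "r *\<^sub>R f = complex_of_real r *\<^sub>C f"
    by (transfer; simp add: scaleR_scaleC)
  show "dist f g = norm (f - g)" "sgn f = inverse (norm f) *\<^sub>R f"
    by (fact dist_cblinfun_def sgn_cblinfun_def)+
  show "(uniformity :: (('a, 'b) cblinfun \<times> ('a, 'b) cblinfun) filter) =
      (INF e\<in>{0 <..}. principal {(f, g). dist f g < e})"
    by (fact uniformity_cblinfun_def)
  show "open S = (\<forall>x\<in>S. \<forall>\<^sub>F (x', y) in uniformity. x' = x \<longrightarrow> y \<in> S)"
    by (fact open_cblinfun_def)
  show "(norm f = 0) = (f = 0)"
    by transfer (auto simp: onorm_eq_0 bounded_clinear_def fun_eq_iff)
  show "norm (f + g) \<le> norm f + norm g"
    by transfer (auto intro: onorm_triangle simp: bounded_clinear_def)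
  show nR: "norm (r *\<^sub>R f) = \<bar>r\<bar> * norm f" for r and f :: "('a, 'b) cblinfun"
    by transfer (simp add: onorm_scaleR bounded_clinear_def)
  have "norm (a *\<^sub>C f) = norm (cmod a *\<^sub>R f)"
    by transfer (simp add: onorm_def norm_scaleC)
  then show "norm (a *\<^sub>C f) = cmod a * norm f"
    by (simp add: nR)
qed

end

type_synonym 'a cdual = "('a, complex) cblinfun"

text \<open>The weak* topology on a dual space: the initial topology with respect to all
  evaluation maps, i.e. the topology of pointwise convergence.  On the function space
  \<^typ>\<open>'a \<Rightarrow> complex\<close> the open sets are those of the product topology.\<close>

definition weak_star :: "'a::complex_normed_vector cdual topology" where
  "weak_star = pullback_topology UNIV cblinfun_apply euclidean"


section \<open>Holomorphic Lipschitz maps on the open unit ball\<close>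

text \<open>Complex Frechet differentiability at every point: the derivative is complex-linear.\<close>

definition holomorphic_map_on ::
    "('a::complex_normed_vector \<Rightarrow> 'b::complex_normed_vector) \<Rightarrow> 'a set \<Rightarrow> bool" where
  "holomorphic_map_on f S \<longleftrightarrow>
     (\<forall>x\<in>S. \<exists>D. bounded_clinear D \<and> (f has_derivative D) (at x within S))"

lemma holomorphic_map_on_add:
  "holomorphic_map_on f S \<Longrightarrow> holomorphic_map_on g S \<Longrightarrow> holomorphic_map_on (\<lambda>x. f x + g x) S"
  unfolding holomorphic_map_on_def
  by (blast intro: bounded_clinear_add has_derivative_add)

lemma holomorphic_map_on_compose:
  assumes "bounded_clinear h" "holomorphic_map_on f S"
  shows "holomorphic_map_on (\<lambda>x. h (f x)) S"
  unfolding holomorphic_map_on_def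
proof
  fix x assume "x \<in> S"
  then obtain D where "bounded_clinear D" "(f has_derivative D) (at x within S)"
    using assms(2) unfolding holomorphic_map_on_def by blast
  moreover have "bounded_linear h" using assms(1) by (simp add: bounded_clinear_def)
  ultimately have "bounded_clinear (\<lambda>x. h (D x))"
      "((\<lambda>x. h (f x)) has_derivative (\<lambda>x. h (D x))) (at x within S)"
    using assms(1) by (auto intro: bounded_clinear_compose bounded_linear.has_derivative)
  then show "\<exists>D. bounded_clinear D \<and> ((\<lambda>x. h (f x)) has_derivative D) (at x within S)"
    by blast
qed

text \<open>A map on the open unit ball is represented by its extension by \<open>0\<close> to the whole space,
  so that equality of representatives is equality on the ball.\<close>

definition HL0_set :: "('a::complex_normed_vector \<Rightarrow> 'b::complex_normed_vector) set" where
  "HL0_set = {f. holomorphic_map_on f (ball 0 1) \<and> (\<exists>K. K-lipschitz_on (ball 0 1) f) \<and>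
     f 0 = 0 \<and> (\<forall>x. x \<notin> ball 0 1 \<longrightarrow> f x = 0)}"

text \<open>The pairs with \<open>x = y\<close> contribute \<open>0 / 0 = 0\<close>; they do not change the supremum, and make it
  range over a nonempty set also if the space is trivial.\<close>

definition lip_norm :: "('a::complex_normed_vector \<Rightarrow> 'b::complex_normed_vector) \<Rightarrow> real" where
  "lip_norm f = (SUP (x, y) \<in> ball 0 1 \<times> ball 0 1. norm (f x - f y) / norm (x - y))"

lemma lip_norm_le:
  assumes "\<And>x y. x \<in> ball 0 1 \<Longrightarrow> y \<in> ball 0 1 \<Longrightarrow> norm (f x - f y) \<le> K * norm (x - y)" "0 \<le> K"
  shows "lip_norm f \<le> K"
  unfolding lip_norm_def
proof (rule cSUP_least)
  show "ball 0 1 \<times> ball (0::'a) 1 \<noteq> {}" by simp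
  fix p :: "'a \<times> 'a" assume "p \<in> ball (0::'a) 1 \<times> ball 0 1"
  then obtain x y where xy: "p = (x, y)" "x \<in> ball 0 1" "y \<in> ball 0 1"
    by blast
  show "(case p of (x, y) \<Rightarrow> norm (f x - f y) / norm (x - y)) \<le> K"
    unfolding xy(1) using assms(1) [OF xy(2,3)] assms(2)
    by (cases "x = y") (simp_all add: divide_le_eq)
qed

lemma lip_norm_bound:
  assumes "f \<in> HL0_set" "x \<in> ball 0 1" "y \<in> ball 0 1"
  shows "norm (f x - f y) \<le> lip_norm f * norm (x - y)"
proof (cases "x = y")
  case False
  obtain K where K: "K-lipschitz_on (ball 0 1) f"
    using assms(1) by (auto simp: HL0_set_def)
  have "norm (f x - f y) / norm (x - y) \<le> K" if "x \<in> ball 0 1" "y \<in> ball 0 1" for x y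
    using lipschitz_onD [OF K that] lipschitz_on_nonneg [OF K]
    by (cases "x = y") (auto simp: dist_norm divide_le_eq)
  then have "bdd_above ((\<lambda>(x, y). norm (f x - f y) / norm (x - y)) ` (ball 0 1 \<times> ball 0 1))"
    by (intro bdd_aboveI2 [where M = K]) auto
  from cSUP_upper [OF _ this, of "(x, y)"] assms
  have "norm (f x - f y) / norm (x - y) \<le> lip_norm f"
    by (simp add: lip_norm_def)
  then show ?thesis using False by (simp add: divide_le_eq)
qed simp

lemma lip_norm_bound0:
  assumes "f \<in> HL0_set"
  shows "norm (f x) \<le> lip_norm f * norm x"
proof (cases "x \<in> ball 0 1")
  case True
  then show ?thesis
    using lip_norm_bound [OF assms True, of 0] assms by (simp add: HL0_set_def)
next
  case False
  have "0 \<le> lip_norm f"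
  proof (rule ccontr)
    assume neg: "\<not> 0 \<le> lip_norm f"
    have "x \<noteq> 0" using False by auto
    define y where "y = (1 / (2 * norm x)) *\<^sub>R x"
    have y: "y \<in> ball 0 1" "norm y = 1 / 2" using \<open>x \<noteq> 0\<close> by (auto simp: y_def)
    have "0 \<le> lip_norm f * norm (y - 0)"
      using lip_norm_bound [OF assms y(1), of 0] norm_ge_zero [of "f y - f 0"]
      by (meson centre_in_ball order_trans zero_less_one)
    with neg y show False by (simp add: zero_le_mult_iff)
  qed
  with False assms show ?thesis by (simp add: HL0_set_def)
qed

lemma lip_norm_nonneg:
  assumes "f \<in> HL0_set"
  shows "0 \<le> lip_norm f"
  unfolding lip_norm_def
proof (rule cSUP_upper2 [where x = "(0, 0)"])
  show "bdd_above ((\<lambda>(x, y). norm (f x - f y) / norm (x - y)) ` (ball 0 1 \<times> ball 0 1))"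
  proof (rule bdd_aboveI2 [where M = "\<bar>lip_norm f\<bar>"])
    fix p :: "'a \<times> 'a" assume p: "p \<in> ball 0 1 \<times> ball 0 1"
    obtain x y where xy: "p = (x, y)" by (cases p)
    have "norm (f x - f y) \<le> lip_norm f * norm (x - y)"
      using lip_norm_bound [OF assms, of x y] p xy by simp
    also have "\<dots> \<le> \<bar>lip_norm f\<bar> * norm (x - y)"
      by (simp add: mult_right_mono)
    finally show "(case p of (x, y) \<Rightarrow> norm (f x - f y) / norm (x - y)) \<le> \<bar>lip_norm f\<bar>"
      unfolding xy by (cases "x = y") (simp_all add: divide_le_eq)
  qed
qed auto

lemma HL0_setI:
  assumes "holomorphic_map_on f (ball 0 1)" "K-lipschitz_on (ball 0 1) f" "f 0 = 0"
    and "\<And>x. x \<notin> ball 0 1 \<Longrightarrow> f x = 0"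
  shows "f \<in> HL0_set"
  using assms unfolding HL0_set_def by blast

lemma HL0_setD:
  assumes "f \<in> HL0_set"
  shows "holomorphic_map_on f (ball 0 1)" "f 0 = 0" "x \<notin> ball 0 1 \<Longrightarrow> f x = 0"
  using assms unfolding HL0_set_def by blast+

lemma HL0_set_zero: "(\<lambda>x. 0) \<in> HL0_set"
proof -
  have "holomorphic_map_on (\<lambda>x. 0) (ball 0 1)"
    unfolding holomorphic_map_on_def
    by (intro ballI exI [of _ "\<lambda>x. 0"] conjI bounded_clinear_zero has_derivative_const)
  moreover have "0-lipschitz_on (ball 0 1) (\<lambda>x. 0)"
    by (rule lipschitz_onI) simp_all
  ultimately show ?thesis unfolding HL0_set_def by blast
qed

lemma HL0_set_add:
  assumes "f \<in> HL0_set" "g \<in> HL0_set"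
  shows "(\<lambda>x. f x + g x) \<in> HL0_set"
proof -
  obtain K L where "K-lipschitz_on (ball 0 1) f" "L-lipschitz_on (ball 0 1) g"
    using assms unfolding HL0_set_def by blast
  then have "(K + L)-lipschitz_on (ball 0 1) (\<lambda>x. f x + g x)"
    by (rule lipschitz_on_add)
  then show ?thesis
    by (rule HL0_setI [rotated])
      (simp_all only: HL0_setD [OF assms(1)] HL0_setD [OF assms(2)] holomorphic_map_on_add add_0
        not_False_eq_True)
qed

lemma HL0_set_compose:
  assumes "bounded_clinear h" "f \<in> HL0_set"
  shows "(\<lambda>x. h (f x)) \<in> HL0_set"
proof -
  have bl: "bounded_linear h" using assms(1) by (simp add: bounded_clinear_def)
  have "norm (h (f x) - h (f y)) \<le> (onorm h * lip_norm f) * norm (x - y)"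
    if "x \<in> ball 0 1" "y \<in> ball 0 1" for x y
  proof -
    have "norm (h (f x) - h (f y)) = norm (h (f x - f y))"
      by (simp add: bl linear_diff bounded_linear.linear)
    also have "\<dots> \<le> onorm h * norm (f x - f y)" by (rule onorm [OF bl])
    also have "\<dots> \<le> onorm h * (lip_norm f * norm (x - y))"
      by (intro mult_left_mono lip_norm_bound assms that onorm_pos_le bl)
    finally show ?thesis by (simp add: mult.assoc)
  qed
  then have "(onorm h * lip_norm f)-lipschitz_on (ball 0 1) (\<lambda>x. h (f x))"
    by (intro lipschitz_onI) (simp_all add: dist_norm onorm_pos_le bl lip_norm_nonneg assms(2))
  moreover have "holomorphic_map_on (\<lambda>x. h (f x)) (ball 0 1)"
    by (rule holomorphic_map_on_compose [OF assms(1) HL0_setD(1) [OF assms(2)]])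
  moreover have "h 0 = 0"
    using linear_0 [OF bounded_linear.linear [OF bl]] .
  ultimately show ?thesis
    by (intro HL0_setI) (simp_all only: HL0_setD [OF assms(2)] not_False_eq_True)
qed

lemma HL0_set_scaleC: "f \<in> HL0_set \<Longrightarrow> (\<lambda>x. a *\<^sub>C f x) \<in> HL0_set"
  by (rule HL0_set_compose [OF bounded_clinear_scaleC])

lemma HL0_set_scaleR: "f \<in> HL0_set \<Longrightarrow> (\<lambda>x. r *\<^sub>R f x) \<in> HL0_set"
  by (simp add: scaleR_scaleC HL0_set_scaleC)

lemma HL0_set_uminus: "f \<in> HL0_set \<Longrightarrow> (\<lambda>x. - f x) \<in> HL0_set"
  using HL0_set_scaleC [of f "- 1"] by simp

lemma HL0_set_diff: "f \<in> HL0_set \<Longrightarrow> g \<in> HL0_set \<Longrightarrow> (\<lambda>x. f x - g x) \<in> HL0_set"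
  using HL0_set_add [OF _ HL0_set_uminus, of f g] by simp

lemma lip_norm_eq_0:
  assumes "f \<in> HL0_set"
  shows "lip_norm f = 0 \<longleftrightarrow> f = (\<lambda>x. 0)"
proof
  assume "lip_norm f = 0"
  then show "f = (\<lambda>x. 0)" using lip_norm_bound0 [OF assms] by (simp add: fun_eq_iff)
next
  assume "f = (\<lambda>x. 0)"
  then have "lip_norm f \<le> 0" by (intro lip_norm_le) auto
  then show "lip_norm f = 0" using lip_norm_nonneg [OF assms] by simp
qed

lemma lip_norm_triangle:
  assumes "f \<in> HL0_set" "g \<in> HL0_set"
  shows "lip_norm (\<lambda>x. f x + g x) \<le> lip_norm f + lip_norm g"
proof (rule lip_norm_le)
  fix x y :: 'a assume xy: "x \<in> ball 0 1" "y \<in> ball 0 1"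
  have "norm (f x + g x - (f y + g y)) \<le> norm (f x - f y) + norm (g x - g y)"
    by (rule norm_diff_triangle_ineq)
  also have "\<dots> \<le> (lip_norm f + lip_norm g) * norm (x - y)"
    using lip_norm_bound [OF assms(1) xy] lip_norm_bound [OF assms(2) xy]
    by (simp add: distrib_right)
  finally show "norm (f x + g x - (f y + g y)) \<le> (lip_norm f + lip_norm g) * norm (x - y)" .
qed (simp add: lip_norm_nonneg assms)

lemma lip_norm_scaleC:
  assumes "f \<in> HL0_set"
  shows "lip_norm (\<lambda>x. a *\<^sub>C f x) = cmod a * lip_norm f"
proof -
  have le: "lip_norm (\<lambda>x. a *\<^sub>C f x) \<le> cmod a * lip_norm f" if "f \<in> HL0_set" for a and f :: "'a \<Rightarrow> 'b"
  proof (rule lip_norm_le)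
    fix x y :: 'a assume xy: "x \<in> ball 0 1" "y \<in> ball 0 1"
    have "norm (a *\<^sub>C f x - a *\<^sub>C f y) = cmod a * norm (f x - f y)"
      by (simp add: complex_vector.scale_right_diff_distrib [symmetric] norm_scaleC)
    also have "\<dots> \<le> cmod a * (lip_norm f * norm (x - y))"
      by (intro mult_left_mono lip_norm_bound that xy) simp
    finally show "norm (a *\<^sub>C f x - a *\<^sub>C f y) \<le> (cmod a * lip_norm f) * norm (x - y)"
      by (simp add: mult.assoc)
  qed (simp add: lip_norm_nonneg that)
  show ?thesis
  proof (cases "a = 0")
    case True
    then show ?thesis
      using lip_norm_eq_0 [OF HL0_set_zero] by simp
  next
    case False
    have "lip_norm f = lip_norm (\<lambda>x. inverse a *\<^sub>C a *\<^sub>C f x)"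
      using False by (simp add: scaleC_scaleC)
    also have "\<dots> \<le> cmod (inverse a) * lip_norm (\<lambda>x. a *\<^sub>C f x)"
      by (rule le [OF HL0_set_scaleC [OF assms]])
    finally have "cmod a * lip_norm f \<le> cmod a * (cmod (inverse a) * lip_norm (\<lambda>x. a *\<^sub>C f x))"
      by (rule mult_left_mono) simp
    also have "\<dots> = lip_norm (\<lambda>x. a *\<^sub>C f x)"
      using False by (simp add: norm_inverse)
    finally have "cmod a * lip_norm f \<le> lip_norm (\<lambda>x. a *\<^sub>C f x)" .
    with le [OF assms, of a] show ?thesis by simp
  qed
qed

typedef (overloaded) ('a, 'b) HL0 =
  "HL0_set :: ('a::complex_normed_vector \<Rightarrow> 'b::complex_normed_vector) set"
  morphisms HL0_apply HL0_Abs
  using HL0_set_zero by blast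

setup_lifting type_definition_HL0

instantiation HL0 :: (complex_normed_vector, complex_normed_vector) complex_normed_vector
begin

lift_definition zero_HL0 :: "('a, 'b) HL0" is "\<lambda>x. 0"
  by (rule HL0_set_zero)
lift_definition plus_HL0 :: "('a, 'b) HL0 \<Rightarrow> ('a, 'b) HL0 \<Rightarrow> ('a, 'b) HL0"
  is "\<lambda>f g x. f x + g x" by (rule HL0_set_add)
lift_definition minus_HL0 :: "('a, 'b) HL0 \<Rightarrow> ('a, 'b) HL0 \<Rightarrow> ('a, 'b) HL0"
  is "\<lambda>f g x. f x - g x" by (rule HL0_set_diff)
lift_definition uminus_HL0 :: "('a, 'b) HL0 \<Rightarrow> ('a, 'b) HL0"
  is "\<lambda>f x. - f x" by (rule HL0_set_uminus)
lift_definition scaleR_HL0 :: "real \<Rightarrow> ('a, 'b) HL0 \<Rightarrow> ('a, 'b) HL0"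
  is "\<lambda>r f x. r *\<^sub>R f x" by (rule HL0_set_scaleR)
lift_definition scaleC_HL0 :: "complex \<Rightarrow> ('a, 'b) HL0 \<Rightarrow> ('a, 'b) HL0"
  is "\<lambda>a f x. a *\<^sub>C f x" by (rule HL0_set_scaleC)
lift_definition norm_HL0 :: "('a, 'b) HL0 \<Rightarrow> real" is lip_norm .

definition dist_HL0 :: "('a, 'b) HL0 \<Rightarrow> ('a, 'b) HL0 \<Rightarrow> real" where
  "dist_HL0 f g = norm (f - g)"
definition sgn_HL0 :: "('a, 'b) HL0 \<Rightarrow> ('a, 'b) HL0" where
  "sgn_HL0 f = inverse (norm f) *\<^sub>R f"
definition uniformity_HL0 :: "(('a, 'b) HL0 \<times> ('a, 'b) HL0) filter" where
  "uniformity_HL0 = (INF e\<in>{0 <..}. principal {(f, g). dist f g < e})"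
definition open_HL0 :: "('a, 'b) HL0 set \<Rightarrow> bool" where
  "open_HL0 S = (\<forall>x\<in>S. \<forall>\<^sub>F (x', y) in uniformity. x' = x \<longrightarrow> y \<in> S)"

instance
proof
  fix f g h :: "('a, 'b) HL0" and r s :: real and a b :: complex and S :: "('a, 'b) HL0 set"
  show "f + g + h = f + (g + h)" "f + g = g + f" "0 + f = f" "- f + f = 0" "f - g = f + - g"
    "r *\<^sub>R (f + g) = r *\<^sub>R f + r *\<^sub>R g" "(r + s) *\<^sub>R f = r *\<^sub>R f + s *\<^sub>R f"
    "r *\<^sub>R s *\<^sub>R f = (r * s) *\<^sub>R f" "1 *\<^sub>R f = f"
    by (transfer; simp add: algebra_simps)+
  show "a *\<^sub>C (f + g) = a *\<^sub>C f + a *\<^sub>C g" "(a + b) *\<^sub>C f = a *\<^sub>C f + b *\<^sub>C f"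
    "a *\<^sub>C b *\<^sub>C f = (a * b) *\<^sub>C f"
    by (transfer; simp add: scaleC_add_left scaleC_add_right scaleC_scaleC)+
  show rc: "r *\<^sub>R f = complex_of_real r *\<^sub>C f" for r and f :: "('a, 'b) HL0"
    by (transfer; simp add: scaleR_scaleC)
  show "dist f g = norm (f - g)" "sgn f = inverse (norm f) *\<^sub>R f"
    by (fact dist_HL0_def sgn_HL0_def)+
  show "(uniformity :: (('a, 'b) HL0 \<times> ('a, 'b) HL0) filter) =
      (INF e\<in>{0 <..}. principal {(f, g). dist f g < e})"
    by (fact uniformity_HL0_def)
  show "open S = (\<forall>x\<in>S. \<forall>\<^sub>F (x', y) in uniformity. x' = x \<longrightarrow> y \<in> S)"
    by (fact open_HL0_def)
  show "(norm f = 0) = (f = 0)"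
    by transfer (rule lip_norm_eq_0)
  show "norm (f + g) \<le> norm f + norm g"
    by transfer (rule lip_norm_triangle)
  show nC: "norm (a *\<^sub>C f) = cmod a * norm f" for a
    by transfer (rule lip_norm_scaleC)
  show "norm (r *\<^sub>R f) = \<bar>r\<bar> * norm f"
    by (simp add: rc nC)
qed

end

text \<open>\<open>f\<^sup>t(y\<^sup>*) = y\<^sup>* \<circ> f\<close>\<close>

lift_definition HL0_transpose ::
    "('a::complex_normed_vector, 'b::complex_normed_vector) HL0 \<Rightarrow> 'b cdual \<Rightarrow> ('a, complex) HL0"
  is "\<lambda>f \<phi>. \<phi> \<circ> f"
  unfolding comp_def by (rule HL0_set_compose)


section \<open>The space \<open>G\<^sub>0\<close> and the weak* topology of \<open>HL\<^sub>0\<close>\<close>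

lift_definition HL0_delta :: "'a::complex_normed_vector \<Rightarrow> ('a, complex) HL0 cdual"
  is "\<lambda>x g. HL0_apply g x"
proof -
  fix x :: 'a
  show "bounded_clinear (\<lambda>g :: ('a, complex) HL0. HL0_apply g x)"
  proof (rule bounded_clinearI [where K = "norm x"])
    fix g :: "('a, complex) HL0"
    show "norm (HL0_apply g x) \<le> norm g * norm x"
      unfolding norm_HL0.rep_eq by (rule lip_norm_bound0 [OF HL0_apply])
  qed (simp_all add: plus_HL0.rep_eq scaleC_HL0.rep_eq)
qed

definition G0_set :: "('a::complex_normed_vector, complex) HL0 cdual set" where
  "G0_set = closure (complex_vector.span (HL0_delta ` ball 0 1))"

lemma G0_set_zero: "0 \<in> G0_set"
  unfolding G0_set_def
  using closure_subset complex_vector.span_zero by blast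

lemma G0_set_add: "x \<in> G0_set \<Longrightarrow> y \<in> G0_set \<Longrightarrow> x + y \<in> G0_set"
  unfolding G0_set_def closure_sequential
  by (elim exE conjE, rule exI, rule conjI [rotated], erule (1) tendsto_add)
    (simp add: complex_vector.span_add)

lemma G0_set_scaleC:
  assumes "x \<in> G0_set"
  shows "a *\<^sub>C x \<in> G0_set"
proof -
  obtain X where X: "\<And>n. X n \<in> complex_vector.span (HL0_delta ` ball 0 1)" "X \<longlonglongrightarrow> x"
    using assms unfolding G0_set_def closure_sequential by blast
  have "(\<lambda>n. a *\<^sub>C X n) \<longlonglongrightarrow> a *\<^sub>C x"
    using bounded_clinear_scaleC [of a] X(2)
    by (auto simp: bounded_clinear_def intro: bounded_linear.tendsto)
  moreover have "a *\<^sub>C X n \<in> complex_vector.span (HL0_delta ` ball 0 1)" for n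
    by (rule complex_vector.span_scale [OF X(1)])
  ultimately show ?thesis
    unfolding G0_set_def closure_sequential by (intro exI [of _ "\<lambda>n. a *\<^sub>C X n"]) simp
qed

lemma G0_set_scaleR: "x \<in> G0_set \<Longrightarrow> r *\<^sub>R x \<in> G0_set"
  by (simp add: scaleR_scaleC G0_set_scaleC)

lemma G0_set_uminus: "x \<in> G0_set \<Longrightarrow> - x \<in> G0_set"
  using G0_set_scaleC [of x "- 1"] by simp

lemma G0_set_diff: "x \<in> G0_set \<Longrightarrow> y \<in> G0_set \<Longrightarrow> x - y \<in> G0_set"
  using G0_set_add [OF _ G0_set_uminus, of x y] by simp

typedef (overloaded) 'a G0 = "G0_set :: ('a::complex_normed_vector, complex) HL0 cdual set"
  morphisms G0_Rep G0_Abs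
  using G0_set_zero by blast

setup_lifting type_definition_G0

instantiation G0 :: (complex_normed_vector) complex_normed_vector
begin

lift_definition zero_G0 :: "'a G0" is 0 by (rule G0_set_zero)
lift_definition plus_G0 :: "'a G0 \<Rightarrow> 'a G0 \<Rightarrow> 'a G0" is "(+)" by (rule G0_set_add)
lift_definition minus_G0 :: "'a G0 \<Rightarrow> 'a G0 \<Rightarrow> 'a G0" is "(-)" by (rule G0_set_diff)
lift_definition uminus_G0 :: "'a G0 \<Rightarrow> 'a G0" is uminus by (rule G0_set_uminus)
lift_definition scaleR_G0 :: "real \<Rightarrow> 'a G0 \<Rightarrow> 'a G0" is scaleR by (rule G0_set_scaleR)
lift_definition scaleC_G0 :: "complex \<Rightarrow> 'a G0 \<Rightarrow> 'a G0" is scaleC by (rule G0_set_scaleC)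
lift_definition norm_G0 :: "'a G0 \<Rightarrow> real" is norm .

definition dist_G0 :: "'a G0 \<Rightarrow> 'a G0 \<Rightarrow> real" where
  "dist_G0 f g = norm (f - g)"
definition sgn_G0 :: "'a G0 \<Rightarrow> 'a G0" where
  "sgn_G0 f = inverse (norm f) *\<^sub>R f"
definition uniformity_G0 :: "('a G0 \<times> 'a G0) filter" where
  "uniformity_G0 = (INF e\<in>{0 <..}. principal {(f, g). dist f g < e})"
definition open_G0 :: "'a G0 set \<Rightarrow> bool" where
  "open_G0 S = (\<forall>x\<in>S. \<forall>\<^sub>F (x', y) in uniformity. x' = x \<longrightarrow> y \<in> S)"

instance
proof
  fix f g h :: "'a G0" and r s :: real and a b :: complex and S :: "'a G0 set"
  show "f + g + h = f + (g + h)" "f + g = g + f" "0 + f = f" "- f + f = 0" "f - g = f + - g"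
    "r *\<^sub>R (f + g) = r *\<^sub>R f + r *\<^sub>R g" "(r + s) *\<^sub>R f = r *\<^sub>R f + s *\<^sub>R f"
    "r *\<^sub>R s *\<^sub>R f = (r * s) *\<^sub>R f" "1 *\<^sub>R f = f"
    by (transfer; simp add: algebra_simps)+
  show "a *\<^sub>C (f + g) = a *\<^sub>C f + a *\<^sub>C g" "(a + b) *\<^sub>C f = a *\<^sub>C f + b *\<^sub>C f"
    "a *\<^sub>C b *\<^sub>C f = (a * b) *\<^sub>C f"
    by (transfer; simp add: scaleC_add_left scaleC_add_right scaleC_scaleC)+
  show "r *\<^sub>R f = complex_of_real r *\<^sub>C f"
    by (transfer; simp add: scaleR_scaleC)
  show "dist f g = norm (f - g)" "sgn f = inverse (norm f) *\<^sub>R f"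
    by (fact dist_G0_def sgn_G0_def)+
  show "(uniformity :: ('a G0 \<times> 'a G0) filter) =
      (INF e\<in>{0 <..}. principal {(f, g). dist f g < e})"
    by (fact uniformity_G0_def)
  show "open S = (\<forall>x\<in>S. \<forall>\<^sub>F (x', y) in uniformity. x' = x \<longrightarrow> y \<in> S)"
    by (fact open_G0_def)
  show "(norm f = 0) = (f = 0)"
    by transfer simp
  show "norm (f + g) \<le> norm f + norm g"
    by transfer (rule norm_triangle_ineq)
  show "norm (r *\<^sub>R f) = \<bar>r\<bar> * norm f"
    by transfer simp
  show "norm (a *\<^sub>C f) = cmod a * norm f"
    by transfer (rule norm_scaleC)
qed

end

text \<open>\<open>\<delta>\<^sub>X\<close> with values in \<open>G\<^sub>0\<close>.  Outside the open unit ball, where \<open>\<delta>\<^sub>X\<close> is not defined,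
  the value is \<open>0\<close>.\<close>

lift_definition G0_delta :: "'a::complex_normed_vector \<Rightarrow> 'a G0"
  is "\<lambda>x. if x \<in> ball 0 1 then HL0_delta x else 0"
proof -
  fix x :: 'a
  have "HL0_delta x \<in> G0_set" if "x \<in> ball 0 1"
    unfolding G0_set_def
    by (rule subsetD [OF closure_subset complex_vector.span_base]) (use that in blast)
  then show "(if x \<in> ball 0 1 then HL0_delta x else 0) \<in> G0_set"
    by (simp add: G0_set_zero)
qed

text \<open>The operator \<open>T\<^sub>f\<close> with \<open>T\<^sub>f \<circ> \<delta>\<^sub>X = f\<close>.\<close>

definition linearization ::
    "('a::complex_normed_vector, 'b::complex_normed_vector) HL0 \<Rightarrow> ('a G0, 'b) cblinfun" where
  "linearization f = (THE T. \<forall>x\<in>ball 0 1. cblinfun_apply T (G0_delta x) = HL0_apply f x)"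

text \<open>For scalar \<open>g\<close> the operator \<open>T\<^sub>g\<close> exists, is unique, and is evaluation at \<open>g\<close>.\<close>

lift_definition G0_eval :: "('a::complex_normed_vector, complex) HL0 \<Rightarrow> 'a G0 cdual"
  is "\<lambda>g \<gamma>. cblinfun_apply (G0_Rep \<gamma>) g"
proof -
  fix g :: "('a, complex) HL0"
  show "bounded_clinear (\<lambda>\<gamma>. cblinfun_apply (G0_Rep \<gamma>) g)"
  proof (rule bounded_clinearI [where K = "norm g"])
    fix \<gamma> :: "'a G0"
    have "bounded_linear (cblinfun_apply (G0_Rep \<gamma>))"
      using cblinfun_apply [of "G0_Rep \<gamma>"] by (simp add: bounded_clinear_def)
    then show "norm (cblinfun_apply (G0_Rep \<gamma>) g) \<le> norm \<gamma> * norm g"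
      unfolding norm_G0.rep_eq norm_cblinfun.rep_eq by (rule onorm)
  qed (simp_all add: plus_G0.rep_eq scaleC_G0.rep_eq plus_cblinfun.rep_eq scaleC_cblinfun.rep_eq)
qed

lemma G0_eval_delta: "x \<in> ball 0 1 \<Longrightarrow> cblinfun_apply (G0_eval g) (G0_delta x) = HL0_apply g x"
  by (simp add: G0_eval.rep_eq G0_delta.rep_eq HL0_delta.rep_eq)

lemma cblinfun_eq_on_G0:
  fixes S T :: "('a::complex_normed_vector G0, 'b::complex_normed_vector) cblinfun"
  assumes eq: "\<And>x. x \<in> ball 0 1 \<Longrightarrow> cblinfun_apply S (G0_delta x) = cblinfun_apply T (G0_delta x)"
  shows "S = T"
proof -
  have span: "\<mu> \<in> G0_set \<and> cblinfun_apply S (G0_Abs \<mu>) = cblinfun_apply T (G0_Abs \<mu>)"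
    if "\<mu> \<in> complex_vector.span (HL0_delta ` ball 0 1)" for \<mu>
    using that
  proof (induction rule: complex_vector.span_induct_alt)
    case base
    have "G0_Abs 0 = (0 :: 'a G0)" by (simp add: zero_G0_def)
    then show ?case
      using bounded_clinear_scale_app [OF cblinfun_apply [simplified], of S 0 0]
        bounded_clinear_scale_app [OF cblinfun_apply [simplified], of T 0 0]
      by (simp add: G0_set_zero)
  next
    case (step c \<nu> \<mu>)
    then obtain x where x: "x \<in> ball 0 1" "\<nu> = HL0_delta x" by blast
    have \<nu>: "\<nu> = G0_Rep (G0_delta x)" using x by (simp add: G0_delta.rep_eq)
    have \<mu>: "\<mu> = G0_Rep (G0_Abs \<mu>)" using step by (simp add: G0_Abs_inverse)
    have sum: "c *\<^sub>C \<nu> + \<mu> = G0_Rep (c *\<^sub>C G0_delta x + G0_Abs \<mu>)"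
      using \<nu> \<mu> by (simp add: plus_G0.rep_eq scaleC_G0.rep_eq)
    have app: "cblinfun_apply R (c *\<^sub>C G0_delta x + G0_Abs \<mu>) =
        c *\<^sub>C cblinfun_apply R (G0_delta x) + cblinfun_apply R (G0_Abs \<mu>)"
      for R :: "('a G0, 'b) cblinfun"
      using cblinfun_apply [of R]
      by (simp add: bounded_clinear_add_app bounded_clinear_scale_app)
    show ?case
      unfolding sum G0_Rep_inverse app using G0_Rep eq [OF x(1)] step by simp
  qed
  have "cblinfun_apply S \<gamma> = cblinfun_apply T \<gamma>" for \<gamma>
  proof -
    obtain X where X: "\<And>n. X n \<in> complex_vector.span (HL0_delta ` ball 0 1)" "X \<longlonglongrightarrow> G0_Rep \<gamma>"
      using G0_Rep [of \<gamma>] unfolding G0_set_def closure_sequential by blast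
    have "dist (G0_Abs (X n)) \<gamma> = dist (X n) (G0_Rep \<gamma>)" for n
      using span [OF X(1)] by (simp add: dist_norm norm_G0.rep_eq minus_G0.rep_eq G0_Abs_inverse)
    then have lim: "(\<lambda>n. G0_Abs (X n)) \<longlonglongrightarrow> \<gamma>"
      using X(2) unfolding tendsto_dist_iff [of X] tendsto_dist_iff [of "\<lambda>n. G0_Abs (X n)"]
      by simp
    have app: "(\<lambda>n. cblinfun_apply R (G0_Abs (X n))) \<longlonglongrightarrow> cblinfun_apply R \<gamma>"
      for R :: "('a G0, 'b) cblinfun"
      using cblinfun_apply [of R] bounded_linear.tendsto [OF _ lim, of "cblinfun_apply R"]
      by (simp add: bounded_clinear_def)
    have "(\<lambda>n. cblinfun_apply S (G0_Abs (X n))) = (\<lambda>n. cblinfun_apply T (G0_Abs (X n)))"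
      using span [OF X(1)] by simp
    then have "(\<lambda>n. cblinfun_apply S (G0_Abs (X n))) \<longlonglongrightarrow> cblinfun_apply T \<gamma>"
      using app [of T] by (simp only:)
    then show ?thesis
      by (rule LIMSEQ_unique [OF app])
  qed
  then show ?thesis by (simp add: cblinfun_apply_inject [symmetric] fun_eq_iff)
qed

lemma linearization_scalar:
  fixes g :: "('a::complex_normed_vector, complex) HL0"
  shows "linearization g = G0_eval g"
  unfolding linearization_def
proof (rule the_equality)
  show "\<forall>x\<in>ball 0 1. cblinfun_apply (G0_eval g) (G0_delta x) = HL0_apply g x"
    by (simp add: G0_eval_delta)
  fix T assume "\<forall>x\<in>ball 0 1. cblinfun_apply T (G0_delta x) = HL0_apply g x"
  then show "T = G0_eval g"
    by (intro cblinfun_eq_on_G0) (simp add: G0_eval_delta)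
qed

definition HL0_Lambda :: "('a::complex_normed_vector, complex) HL0 \<Rightarrow> 'a G0 cdual" where
  "HL0_Lambda g = linearization g"

definition HL0_weak_star :: "('a::complex_normed_vector, complex) HL0 topology" where
  "HL0_weak_star = pullback_topology UNIV HL0_Lambda weak_star"

text \<open>All linear operators that are continuous for the two weak* topologies; norm boundedness is
  not part of the definition.\<close>

definition weak_star_operators ::
    "('b::complex_normed_vector cdual \<Rightarrow> ('a::complex_normed_vector, complex) HL0) set" where
  "weak_star_operators = {T. clinear T \<and> continuous_map weak_star HL0_weak_star T}"

end

theory Submission
  imports Defs "HOL-Complex_Analysis.Conformal_Mappings"
begin

text \<open>
  Write \<open>\<delta>\<close> for the evaluation map of the ball into \<open>G\<^sub>0\<close>.  Linearity of \<open>f \<mapsto> f\<^sup>t\<close> is clear, and the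
  isometry is the Hahn--Banach theorem: a vector \<open>v\<close> of \<open>Y\<close> has norm at most \<open>C\<close> as soon as
  \<open>\<bar>\<phi> v\<bar> \<le> C \<parallel>\<phi>\<parallel>\<close> for all functionals \<open>\<phi>\<close> (\<open>norm_le_dual\<close>), which is applied to the differences
  \<open>f x - f y\<close>.

  The topology of \<open>HL\<^sub>0\<close> is the initial one for the evaluations at the elements \<open>\<gamma>\<close> of \<open>G\<^sub>0\<close>.  So
  \<open>f\<^sup>t\<close> is weak*-to-weak* continuous if every functional \<open>\<phi> \<mapsto> \<gamma> (\<phi> \<circ> f)\<close> on \<open>Y\<^sup>*\<close> is the evaluation
  at a vector of \<open>Y\<close>.  For \<open>\<gamma>\<close> in the span of \<open>\<delta>\<close> the vector is a linear combination of values of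
  \<open>f\<close>; a general \<open>\<gamma>\<close> is a norm limit of such elements, and the evaluations at vectors of the Banach
  space \<open>Y\<close> form a norm closed set of functionals (\<open>evaluation_closed_in_bidual\<close>).

  Conversely let \<open>T\<close> be weak*-to-weak* continuous and linear.  For each \<open>x\<close> in the ball the functional
  \<open>\<phi> \<mapsto> T \<phi> x\<close> is weak* continuous, hence the evaluation at a vector \<open>f x\<close>
  (\<open>weak_star_continuous_functional\<close>), and \<open>T \<phi> = \<phi> \<circ> f\<close>.  What has to be shown is that \<open>f\<close> is
  holomorphic and Lipschitz, knowing this only after composition with functionals.  The difference
  quotients of \<open>f\<close> are weakly bounded, since \<open>\<parallel>T \<phi>\<parallel>\<close> is a Lipschitz constant of \<open>\<phi> \<circ> f\<close>, and hence
  bounded by the uniform boundedness principle.  Once \<open>f\<close> is Lipschitz, the Schwarz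
  lemma bounds the first order Taylor remainder of \<open>\<phi> \<circ> f\<close> quadratically and uniformly for \<open>\<phi>\<close> in
  the dual unit ball.  Therefore the directional difference quotients of \<open>f\<close> converge in norm, and
  their limits form a Frechet derivative (\<open>weakly_holomorphic_lipschitz_imp_holomorphic\<close>).
\<close>

section \<open>Bounded functionals\<close>

lemma bounded_clinear_cblinfun [simp]: "bounded_clinear (cblinfun_apply \<phi>)"
  using cblinfun_apply [of \<phi>] by simp

lemma bounded_linear_cblinfun [simp]: "bounded_linear (cblinfun_apply \<phi>)"
  using bounded_clinear_cblinfun [of \<phi>] by (simp only: bounded_clinear_def)

lemmas cblinfun_linear_simps =
  bounded_clinear_add_app [OF bounded_clinear_cblinfun]
  bounded_clinear_scale_app [OF bounded_clinear_cblinfun]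
  linear_diff [OF bounded_linear.linear [OF bounded_linear_cblinfun]]
  linear_0 [OF bounded_linear.linear [OF bounded_linear_cblinfun]]

lemma norm_cblinfun_apply: "norm (cblinfun_apply \<phi> x) \<le> norm \<phi> * norm x"
  unfolding norm_cblinfun.rep_eq by (rule onorm [OF bounded_linear_cblinfun])

lemma norm_cblinfun_le:
  assumes "0 \<le> K" "\<And>x. norm (cblinfun_apply \<phi> x) \<le> K * norm x"
  shows "norm \<phi> \<le> K"
  unfolding norm_cblinfun.rep_eq by (rule onorm_bound) (use assms in auto)

lemma cblinfun_scaleR: "cblinfun_apply \<phi> (r *\<^sub>R y) = r *\<^sub>R cblinfun_apply \<phi> y"
  by (rule linear_scale [OF bounded_linear.linear [OF bounded_linear_cblinfun]])

section \<open>The Hahn--Banach theorem\<close>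

definition sublinear :: "('a::real_vector \<Rightarrow> real) \<Rightarrow> bool" where
  "sublinear p \<longleftrightarrow> (\<forall>x y. p (x + y) \<le> p x + p y) \<and> (\<forall>c\<ge>0. \<forall>x. p (c *\<^sub>R x) = c * p x)"

lemma sublinear_add: "sublinear p \<Longrightarrow> p (x + y) \<le> p x + p y"
  by (simp add: sublinear_def)

lemma sublinear_scaleR: "sublinear p \<Longrightarrow> 0 \<le> c \<Longrightarrow> p (c *\<^sub>R x) = c * p x"
  by (simp add: sublinear_def)

lemma sublinear_0: "sublinear p \<Longrightarrow> p 0 = 0"
  using sublinear_scaleR [of p 0 0] by simp

lemma sublinear_ge_uminus: "sublinear p \<Longrightarrow> - p (- x) \<le> p x"
  using sublinear_add [of p x "- x"] sublinear_0 [of p] by simp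

lemma sublinearI:
  assumes add: "\<And>x y. p (x + y) \<le> p x + p y"
    and scale: "\<And>c x. 0 < c \<Longrightarrow> p (c *\<^sub>R x) \<le> c * p x"
    and zero: "p 0 = 0"
  shows "sublinear p"
  unfolding sublinear_def
proof (intro conjI allI impI add)
  fix c :: real and x assume "0 \<le> c"
  show "p (c *\<^sub>R x) = c * p x"
  proof (cases "c = 0")
    case False
    with \<open>0 \<le> c\<close> have c: "0 < c" by simp
    have "p x \<le> inverse c * p (c *\<^sub>R x)"
      using scale [of "inverse c" "c *\<^sub>R x"] c by simp
    then have "c * p x \<le> p (c *\<^sub>R x)"
      using c by (simp add: field_simps)
    with scale [OF c, of x] show ?thesis by simp
  qed (simp add: zero)
qed

text \<open>Lowering a sublinear functional towards the ray through \<open>z\<close>: \<open>q x\<close> is the infimum of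
  \<open>p (x + t z) - t p z\<close> over \<open>t \<ge> 0\<close>, which is bounded below because \<open>t p z = p (t z)\<close>.  The choice
  \<open>t = 1\<close> gives the bound at \<open>- z\<close>.  For a minimal \<open>p\<close> this forces \<open>p (- z) = - p z\<close>; if \<open>p\<close> is
  the norm, every linear functional below \<open>q\<close> attains the norm at \<open>z\<close>.\<close>

lemma sublinear_tilt:
  fixes p :: "'a::real_vector \<Rightarrow> real"
  assumes p: "sublinear p"
  obtains q where "sublinear q" "q \<le> p" "q (- z) \<le> - p z"
proof
  define q where "q x = (INF t\<in>{0..}. p (x + t *\<^sub>R z) - t * p z)" for x
  have lower: "- p (- x) \<le> p (x + t *\<^sub>R z) - t * p z" if "0 \<le> t" for x t
    using sublinear_add [OF p, of "x + t *\<^sub>R z" "- x"] sublinear_scaleR [OF p that, of z] by simp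
  have upper: "q x \<le> p (x + t *\<^sub>R z) - t * p z" if "0 \<le> t" for x t
    unfolding q_def
    by (rule cINF_lower) (use that lower in \<open>auto intro!: bdd_belowI2\<close>)
  have greatest: "m \<le> q x" if "\<And>t. 0 \<le> t \<Longrightarrow> m \<le> p (x + t *\<^sub>R z) - t * p z" for m x
    unfolding q_def by (rule cINF_greatest) (use that in auto)
  show "q \<le> p"
    using upper [of 0] by (simp add: le_fun_def)
  show "q (- z) \<le> - p z"
    using upper [of 1 "- z"] sublinear_0 [OF p] by simp
  show "sublinear q"
  proof (rule sublinearI)
    fix x y
    have "q (x + y) \<le> (p (x + s *\<^sub>R z) - s * p z) + (p (y + t *\<^sub>R z) - t * p z)"
      if "0 \<le> s" "0 \<le> t" for s t
      using upper [of "s + t" "x + y"] that sublinear_add [OF p, of "x + s *\<^sub>R z" "y + t *\<^sub>R z"]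
      by (simp add: algebra_simps)
    then have "q (x + y) - (p (x + s *\<^sub>R z) - s * p z) \<le> q y" if "0 \<le> s" for s
      by (intro greatest) (use that in \<open>force simp: algebra_simps\<close>)
    then have "q (x + y) - q y \<le> q x"
      by (intro greatest) (simp add: algebra_simps)
    then show "q (x + y) \<le> q x + q y" by simp
  next
    fix c :: real and x assume c: "0 < c"
    have "q (c *\<^sub>R x) \<le> c * (p (x + t *\<^sub>R z) - t * p z)" if "0 \<le> t" for t
      using upper [of "c * t" "c *\<^sub>R x"] that c sublinear_scaleR [OF p, of c "x + t *\<^sub>R z"]
      by (simp add: algebra_simps)
    then have "q (c *\<^sub>R x) / c \<le> q x"
      by (intro greatest) (use c in \<open>simp add: divide_le_eq mult.commute\<close>)
    then show "q (c *\<^sub>R x) \<le> c * q x"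
      using c by (simp add: divide_le_eq mult.commute)
  next
    show "q 0 = 0"
      using upper [of 0 0] greatest [of 0 0] lower [of _ 0] sublinear_0 [OF p]
      by (auto intro: antisym)
  qed
qed

text \<open>Zorn's lemma for the reverse order: the pointwise infimum of a chain is finite, since every member
  \<open>q\<close> satisfies \<open>q x \<ge> - q (- x) \<ge> - p (- x)\<close>, and it is subadditive since of two members of the
  chain the smaller one can be used for both arguments.\<close>

lemma minimal_sublinear_exists:
  fixes p :: "'a::real_vector \<Rightarrow> real"
  assumes p: "sublinear p"
  obtains u where "sublinear u" "u \<le> p" "\<And>q. sublinear q \<Longrightarrow> q \<le> u \<Longrightarrow> q = u"
proof -
  define A where "A = {q. sublinear q \<and> q \<le> p}"
  have "\<exists>u\<in>A. \<forall>q\<in>A. q \<le> u \<longrightarrow> q = u"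
  proof (rule predicate_Zorn)
    show "partial_order_on A (relation_of (\<lambda>u q. q \<le> u) A)"
      by (rule partial_order_on_relation_ofI) auto
    fix C assume "C \<in> Chains (relation_of (\<lambda>u q. q \<le> u) A)"
    then have CA: "C \<subseteq> A" and chain: "\<And>q r. q \<in> C \<Longrightarrow> r \<in> C \<Longrightarrow> q \<le> r \<or> r \<le> q"
      by (auto simp: Chains_def relation_of_def)
    show "\<exists>u\<in>A. \<forall>q\<in>C. u \<le> q"
    proof (cases "C = {}")
      case True
      then show ?thesis using p by (auto simp: A_def)
    next
      case False
      define u where "u x = (INF q\<in>C. q x)" for x
      have lower: "- p (- x) \<le> q x" if "q \<in> C" for q x
      proof -
        have "sublinear q" "q (- x) \<le> p (- x)"
          using that CA by (auto simp: A_def le_fun_def)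
        with sublinear_ge_uminus [of q x] show ?thesis by simp
      qed
      have upper: "u x \<le> q x" if "q \<in> C" for q x
        unfolding u_def
        by (rule cINF_lower) (use that lower in \<open>auto intro!: bdd_belowI2\<close>)
      have greatest: "m \<le> u x" if "\<And>q. q \<in> C \<Longrightarrow> m \<le> q x" for m x
        unfolding u_def by (rule cINF_greatest) (use that False in auto)
      have sub: "sublinear q" if "q \<in> C" for q
        using that CA by (auto simp: A_def)
      have "sublinear u"
      proof (rule sublinearI)
        fix x y
        have "u (x + y) \<le> q x + r y" if qr: "q \<in> C" "r \<in> C" for q r
        proof -
          from chain [OF qr] obtain m where "m \<in> C" "m \<le> q" "m \<le> r"
            using qr by blast
          then have "u (x + y) \<le> m x + m y" "m x \<le> q x" "m y \<le> r y"
            using upper [of m "x + y"] sublinear_add [OF sub, of m x y] by (auto simp: le_fun_def)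
          then show ?thesis by simp
        qed
        then have "u (x + y) - q x \<le> u y" if "q \<in> C" for q
          by (intro greatest) (use that in \<open>force simp: algebra_simps\<close>)
        then have "u (x + y) - u y \<le> u x"
          by (intro greatest) (simp add: algebra_simps)
        then show "u (x + y) \<le> u x + u y" by simp
      next
        fix c :: real and x assume c: "0 < c"
        have "u (c *\<^sub>R x) \<le> c * q x" if "q \<in> C" for q
          using upper [OF that, of "c *\<^sub>R x"] sublinear_scaleR [OF sub [OF that], of c x] c by simp
        then have "u (c *\<^sub>R x) / c \<le> u x"
          by (intro greatest) (use c in \<open>simp add: divide_le_eq mult.commute\<close>)
        then show "u (c *\<^sub>R x) \<le> c * u x"
          using c by (simp add: divide_le_eq mult.commute)
      next
        from False obtain q where "q \<in> C" by blast
        then have "u 0 \<le> 0"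
          using upper [of q 0] sublinear_0 [OF sub, of q] by simp
        moreover have "0 \<le> u 0"
        proof (rule greatest)
          show "0 \<le> r 0" if "r \<in> C" for r
            using sublinear_0 [OF sub [OF that]] by simp
        qed
        ultimately show "u 0 = 0" by simp
      qed
      moreover have "u \<le> p"
      proof -
        obtain q where "q \<in> C" using False by blast
        then have "u \<le> q" "q \<le> p"
          using CA upper [of q] by (auto simp: A_def intro: le_funI)
        then show ?thesis by (rule order_trans)
      qed
      ultimately show ?thesis
        using upper by (intro bexI [of _ u] ballI le_funI) (simp_all add: A_def)
    qed
  qed
  then obtain u where u: "u \<in> A" "\<And>q. q \<in> A \<Longrightarrow> q \<le> u \<Longrightarrow> q = u"
    by blast
  show thesis
  proof (rule that)
    show "sublinear u" "u \<le> p" using u(1) by (simp_all add: A_def)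
    show "q = u" if "sublinear q" "q \<le> u" for q
      using that u(1) by (intro u(2)) (auto simp: A_def intro: order_trans)
  qed
qed

text \<open>The Hahn--Banach theorem by minimality instead of extension from subspaces: a minimal
  sublinear functional cannot be lowered by tilting, so it is odd, and an odd sublinear functional is linear.\<close>

lemma sublinear_dominates_linear:
  fixes p :: "'a::real_vector \<Rightarrow> real"
  assumes p: "sublinear p"
  obtains u where "linear u" "u \<le> p"
proof -
  obtain u where u: "sublinear u" "u \<le> p" and min: "\<And>q. sublinear q \<Longrightarrow> q \<le> u \<Longrightarrow> q = u"
    using minimal_sublinear_exists [OF p] by blast
  have neg: "u (- z) = - u z" for z
  proof -
    obtain q where "sublinear q" "q \<le> u" "q (- z) \<le> - u z"
      using sublinear_tilt [OF u(1)] by blast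
    with min have "u (- z) \<le> - u z" by blast
    with sublinear_ge_uminus [OF u(1), of z] show ?thesis by simp
  qed
  have "linear u"
  proof (rule linearI)
    show "u (x + y) = u x + u y" for x y
      using sublinear_add [OF u(1), of x y] sublinear_add [OF u(1), of "- x" "- y"]
        neg [of "x + y"] neg [of x] neg [of y] by simp
    show "u (c *\<^sub>R x) = c *\<^sub>R u x" for c x
    proof (cases "0 \<le> c")
      case False
      then show ?thesis
        using sublinear_scaleR [OF u(1), of "- c" x] neg [of "c *\<^sub>R x"] by simp
    qed (simp add: sublinear_scaleR [OF u(1)])
  qed
  with u(2) show thesis by (rule that [rotated -1])
qed

lemma real_norming_functional:
  fixes y :: "'a::real_normed_vector"
  obtains u :: "'a \<Rightarrow> real" where "linear u" "\<And>x. \<bar>u x\<bar> \<le> norm x" "u y = norm y"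
proof -
  have "sublinear (norm :: 'a \<Rightarrow> real)"
    by (simp add: sublinear_def norm_triangle_ineq)
  then obtain q :: "'a \<Rightarrow> real" where q: "sublinear q" "q \<le> norm" "q (- y) \<le> - norm y"
    using sublinear_tilt by blast
  obtain u where u: "linear u" "u \<le> q"
    using sublinear_dominates_linear [OF q(1)] by blast
  have le: "u x \<le> norm x" for x
    using u(2) q(2) by (auto simp: le_fun_def intro: order_trans)
  have neg: "u (- x) = - u x" for x
    by (rule linear_neg [OF u(1)])
  have "norm y \<le> u y"
    using u(2) q(3) neg [of y] by (auto simp: le_fun_def dest!: spec [of _ "- y"])
  show thesis
  proof (rule that [OF u(1)])
    show "\<bar>u x\<bar> \<le> norm x" for x
      using le [of x] le [of "- x"] neg [of x] by auto
    show "u y = norm y"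
      using \<open>norm y \<le> u y\<close> le [of y] by simp
  qed
qed

text \<open>The usual complexification \<open>x \<mapsto> u x - \<i> u (\<i> x)\<close>.\<close>

lemma complexify_functional:
  fixes u :: "'a::complex_normed_vector \<Rightarrow> real"
  assumes u: "linear u" and le: "\<And>x. \<bar>u x\<bar> \<le> K * norm x" and "0 \<le> K"
  obtains \<phi> :: "'a cdual" where "norm \<phi> \<le> K" "\<And>x. Re (cblinfun_apply \<phi> x) = u x"
proof -
  define f where "f x = Complex (u x) (- u (\<i> *\<^sub>C x))" for x
  have add: "f (x + y) = f x + f y" for x y
    by (simp add: f_def complex_eq_iff linear_add [OF u] scaleC_add_right)
  have real: "u (of_real r *\<^sub>C x) = r * u x" for r x
    using linear_scale [OF u, of r x] by (simp add: scaleR_scaleC)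
  have scale: "f (a *\<^sub>C x) = a *\<^sub>C f x" for a x
  proof -
    have 1: "a *\<^sub>C x = of_real (Re a) *\<^sub>C x + of_real (Im a) *\<^sub>C (\<i> *\<^sub>C x)"
      by (simp add: scaleC_scaleC scaleC_add_left [symmetric])
        (metis complex_eq mult.commute)
    have 2: "\<i> *\<^sub>C a *\<^sub>C x = of_real (Re a) *\<^sub>C (\<i> *\<^sub>C x) + of_real (- Im a) *\<^sub>C x"
    proof -
      have "\<i> * a = of_real (Re a) * \<i> + of_real (- Im a)"
        by (simp add: complex_eq_iff)
      then show ?thesis by (simp only: scaleC_scaleC scaleC_add_left [symmetric])
    qed
    have "u (a *\<^sub>C x) = Re a * u x + Im a * u (\<i> *\<^sub>C x)"
      unfolding 1 linear_add [OF u] real ..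
    moreover have "u (\<i> *\<^sub>C a *\<^sub>C x) = Re a * u (\<i> *\<^sub>C x) + (- Im a) * u x"
      unfolding 2 linear_add [OF u] real ..
    ultimately show ?thesis
      by (simp add: f_def scaleC_complex_def complex_eq_iff algebra_simps)
  qed
  have bound: "norm (f x) \<le> K * norm x" for x
  proof (cases "f x = 0")
    case False
    \<comment> \<open>rotate \<^term>\<open>x\<close> so that the functional takes a nonnegative real value\<close>
    define a where "a = cnj (f x) / of_real (cmod (f x))"
    have a: "cmod a = 1" using False by (simp add: a_def norm_divide)
    have "a * f x = of_real (cmod (f x))"
      using False by (simp add: a_def complex_norm_square [symmetric] field_simps power2_eq_square)
    then have "cmod (f x) = Re (f (a *\<^sub>C x))"
      by (simp add: scale scaleC_complex_def)
    also have "\<dots> = u (a *\<^sub>C x)" by (simp add: f_def)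
    also have "\<dots> \<le> K * norm x"
      using le [of "a *\<^sub>C x"] a by (simp add: norm_scaleC)
    finally show ?thesis .
  qed (simp add: \<open>0 \<le> K\<close>)
  have "bounded_clinear f"
    by (rule bounded_clinearI [where K = K]) (use add scale bound in \<open>auto simp: mult.commute\<close>)
  then have app: "cblinfun_apply (CBlinfun f) = f"
    by (simp add: CBlinfun_inverse)
  show thesis
  proof (rule that [of "CBlinfun f"])
    show "norm (CBlinfun f) \<le> K"
      by (rule norm_cblinfun_le) (use bound app \<open>0 \<le> K\<close> in auto)
    show "Re (cblinfun_apply (CBlinfun f) x) = u x" for x
      by (simp add: app f_def)
  qed
qed

lemma norming_functional:
  fixes y :: "'a::complex_normed_vector"
  obtains \<phi> :: "'a cdual" where "norm \<phi> \<le> 1" "cmod (cblinfun_apply \<phi> y) = norm y"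
proof -
  obtain u :: "'a \<Rightarrow> real" where u: "linear u" "\<And>x. \<bar>u x\<bar> \<le> norm x" "u y = norm y"
    using real_norming_functional by blast
  obtain \<phi> :: "'a cdual" where \<phi>: "norm \<phi> \<le> 1" "\<And>x. Re (cblinfun_apply \<phi> x) = u x"
    using complexify_functional [OF u(1), of 1] u(2) by auto
  have "norm y \<le> cmod (cblinfun_apply \<phi> y)"
    using complex_Re_le_cmod [of "cblinfun_apply \<phi> y"] \<phi>(2) u(3) by simp
  moreover have "cmod (cblinfun_apply \<phi> y) \<le> norm y"
    using norm_cblinfun_apply [of \<phi> y] mult_right_mono [OF \<phi>(1), of "norm y"] by simp
  ultimately show thesis
    using that \<phi>(1) by force
qed

text \<open>The form in which the Hahn--Banach theorem is used below: bounds for vectors are read off from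
  bounds that are uniform on the dual unit ball.\<close>

lemma norm_le_dual:
  fixes y :: "'a::complex_normed_vector"
  assumes "\<And>\<phi> :: 'a cdual. cmod (cblinfun_apply \<phi> y) \<le> K * norm \<phi>" "0 \<le> K"
  shows "norm y \<le> K"
proof -
  obtain \<phi> :: "'a cdual" where \<phi>: "norm \<phi> \<le> 1" "cmod (cblinfun_apply \<phi> y) = norm y"
    using norming_functional by blast
  have "norm y \<le> K * norm \<phi>" using assms(1) [of \<phi>] \<phi>(2) by simp
  also have "\<dots> \<le> K" using \<phi>(1) \<open>0 \<le> K\<close> by (simp add: mult_left_le)
  finally show ?thesis .
qed

lemma dual_separates:
  fixes y z :: "'a::complex_normed_vector"
  assumes "\<And>\<phi> :: 'a cdual. cblinfun_apply \<phi> y = cblinfun_apply \<phi> z"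
  shows "y = z"
  using norm_le_dual [of "y - z" 0] assms by (simp add: cblinfun_linear_simps)

section \<open>Weak boundedness and the closedness of a Banach space in its bidual\<close>

text \<open>The uniform boundedness principle for evaluations on the dual space, which is complete.
  By Baire's theorem one of the closed sets of functionals that are bounded
  by \<open>n\<close> on \<open>K\<close> contains a ball; moving inside this ball along a norming functional of \<open>y\<close> bounds
  the norm of \<open>y\<close>.\<close>

lemma weakly_bounded_imp_bounded:
  fixes K :: "'a::real_normed_vector set"
  assumes weak: "\<And>u :: 'a \<Rightarrow>\<^sub>L real. \<exists>C. \<forall>y\<in>K. \<bar>blinfun_apply u y\<bar> \<le> C"
  shows "bounded K"
proof -
  define E where "E n = {u :: 'a \<Rightarrow>\<^sub>L real. \<forall>y\<in>K. \<bar>blinfun_apply u y\<bar> \<le> real n}" for n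
  have closed: "closed (E n)" for n
  proof -
    have "E n = (\<Inter>y\<in>K. {u. \<bar>blinfun_apply u y\<bar> \<le> real n})"
      by (auto simp: E_def)
    also have "closed \<dots>"
      by (intro closed_INT ballI closed_Collect_le continuous_intros)
    finally show ?thesis .
  qed
  have "(\<Union>n. E n) = UNIV"
  proof -
    have "u \<in> (\<Union>n. E n)" for u
    proof -
      obtain C where C: "\<forall>y\<in>K. \<bar>blinfun_apply u y\<bar> \<le> C" using weak by blast
      obtain n where "C \<le> real n" using real_arch_simple by blast
      with C have "u \<in> E n" by (force simp: E_def)
      then show ?thesis by blast
    qed
    then show ?thesis by blast
  qed
  then have "interior (\<Union>(range E)) \<noteq> {}"
    by simp
  then obtain n where "interior (E n) \<noteq> {}"
    using Baire_category_alt [of "euclidean :: ('a \<Rightarrow>\<^sub>L real) topology" "range E"] closed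
      completely_metrizable_space_euclidean
    by auto
  then obtain u0 e where e: "0 < e" "ball u0 e \<subseteq> E n"
    by (auto simp: mem_interior)
  have "norm y \<le> 4 * real n / e" if y: "y \<in> K" for y
  proof -
    obtain v :: "'a \<Rightarrow> real" where v: "linear v" "\<And>x. \<bar>v x\<bar> \<le> norm x" "v y = norm y"
      using real_norming_functional by blast
    have "bounded_linear v"
      by (rule bounded_linear_intro [where K = 1])
        (use v(2) in \<open>auto simp: linear_add [OF v(1)] linear_scale [OF v(1)]\<close>)
    define w where "w = Blinfun v"
    have w: "blinfun_apply w = v"
      unfolding w_def by (rule bounded_linear_Blinfun_apply [OF \<open>bounded_linear v\<close>])
    have "norm w \<le> 1"
      by (rule norm_blinfun_bound) (use v(2) w in auto)
    then have "u0 + (e / 2) *\<^sub>R w \<in> ball u0 e" "u0 \<in> ball u0 e"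
      using e(1) by (auto simp: dist_norm)
    then have "\<bar>blinfun_apply u0 y + e / 2 * norm y\<bar> \<le> real n" "\<bar>blinfun_apply u0 y\<bar> \<le> real n"
      using e(2) y v(3) unfolding E_def
      by (fastforce simp: blinfun.add_left blinfun.scaleR_left w)+
    then have "e / 2 * norm y \<le> 2 * real n" by linarith
    then show ?thesis using e(1) by (simp add: field_simps)
  qed
  then show ?thesis
    by (auto simp: bounded_iff)
qed

lemma weakly_bounded_imp_bounded_complex:
  fixes K :: "'a::complex_normed_vector set"
  assumes weak: "\<And>\<phi> :: 'a cdual. \<exists>C. \<forall>y\<in>K. cmod (cblinfun_apply \<phi> y) \<le> C"
  shows "bounded K"
proof (rule weakly_bounded_imp_bounded)
  fix u :: "'a \<Rightarrow>\<^sub>L real"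
  obtain \<phi> :: "'a cdual" where \<phi>: "\<And>x. Re (cblinfun_apply \<phi> x) = blinfun_apply u x"
  proof (rule complexify_functional)
    show "linear (blinfun_apply u)"
      by (simp add: blinfun.bounded_linear_right bounded_linear.linear)
    show "\<bar>blinfun_apply u x\<bar> \<le> norm u * norm x" for x
      using norm_blinfun [of u x] by simp
  qed (use that in auto)
  obtain C where C: "\<forall>y\<in>K. cmod (cblinfun_apply \<phi> y) \<le> C" using weak by blast
  have "\<bar>blinfun_apply u y\<bar> \<le> C" if "y \<in> K" for y
    using abs_Re_le_cmod [of "cblinfun_apply \<phi> y"] \<phi> [of y] C that by fastforce
  then show "\<exists>C. \<forall>y\<in>K. \<bar>blinfun_apply u y\<bar> \<le> C" by blast
qed

text \<open>The canonical image of a Banach space is norm closed in its bidual: by the norm formula for vectors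
  the \<open>y n\<close> form a Cauchy sequence.  This produces both the vectors that represent
  the functionals \<open>\<phi> \<mapsto> \<gamma> (\<phi> \<circ> f)\<close> for \<open>\<gamma>\<close> in \<open>G\<^sub>0\<close> and the directional derivatives of weakly holomorphic maps.\<close>

lemma evaluation_closed_in_bidual:
  fixes y :: "nat \<Rightarrow> 'a::complex_banach" and \<Lambda> :: "'a cdual \<Rightarrow> complex"
  assumes err: "\<And>n \<phi>. cmod (cblinfun_apply \<phi> (y n) - \<Lambda> \<phi>) \<le> e n * norm \<phi>"
    and e: "e \<longlonglongrightarrow> 0"
  obtains l where "y \<longlonglongrightarrow> l" "\<And>\<phi>. cblinfun_apply \<phi> l = \<Lambda> \<phi>"
proof -
  have "Cauchy y"
  proof (rule metric_CauchyI)
    fix r :: real assume "0 < r"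
    then obtain N where N: "\<And>n. N \<le> n \<Longrightarrow> \<bar>e n\<bar> < r / 3"
      using LIMSEQ_D [OF e, of "r / 3"] by auto
    have "dist (y m) (y n) < r" if mn: "N \<le> m" "N \<le> n" for m n
    proof -
      have "norm (y m - y n) \<le> 2 * r / 3"
      proof (rule norm_le_dual)
        fix \<phi> :: "'a cdual"
        have "cmod (cblinfun_apply \<phi> (y m - y n)) \<le>
            cmod (cblinfun_apply \<phi> (y m) - \<Lambda> \<phi>) + cmod (cblinfun_apply \<phi> (y n) - \<Lambda> \<phi>)"
          using norm_triangle_ineq4 [of "cblinfun_apply \<phi> (y m) - \<Lambda> \<phi>" "cblinfun_apply \<phi> (y n) - \<Lambda> \<phi>"]
          by (simp add: cblinfun_linear_simps)
        also have "\<dots> \<le> r / 3 * norm \<phi> + r / 3 * norm \<phi>"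
          using err [of \<phi> m] err [of \<phi> n] N [OF mn(1)] N [OF mn(2)]
          by (intro add_mono; elim order_trans; intro mult_right_mono) auto
        finally show "cmod (cblinfun_apply \<phi> (y m - y n)) \<le> 2 * r / 3 * norm \<phi>"
          by simp
      qed (use \<open>0 < r\<close> in simp)
      then show ?thesis using \<open>0 < r\<close> by (simp add: dist_norm)
    qed
    then show "\<exists>M. \<forall>m\<ge>M. \<forall>n\<ge>M. dist (y m) (y n) < r" by blast
  qed
  then obtain l where l: "y \<longlonglongrightarrow> l"
    using Cauchy_convergent_iff convergent_def by blast
  show thesis
  proof (rule that [OF l])
    fix \<phi> :: "'a cdual"
    have "(\<lambda>n. e n * norm \<phi>) \<longlonglongrightarrow> 0"
      using tendsto_mult_left_zero [OF e] by blast
    then have "(\<lambda>n. cblinfun_apply \<phi> (y n) - \<Lambda> \<phi>) \<longlonglongrightarrow> 0"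
      by (rule Lim_null_comparison [rotated]) (use err in simp)
    then have "(\<lambda>n. cblinfun_apply \<phi> (y n)) \<longlonglongrightarrow> \<Lambda> \<phi>"
      by (simp add: LIM_zero_iff)
    moreover have "(\<lambda>n. cblinfun_apply \<phi> (y n)) \<longlonglongrightarrow> cblinfun_apply \<phi> l"
      by (rule bounded_linear.tendsto [OF bounded_linear_cblinfun l])
    ultimately show "cblinfun_apply \<phi> l = \<Lambda> \<phi>"
      using LIMSEQ_unique by blast
  qed
qed

section \<open>Weak* continuous functionals\<close>

lemma continuous_map_weak_star_apply:
  "continuous_map weak_star euclidean (\<lambda>\<phi>. cblinfun_apply \<phi> y)"
proof -
  have "continuous_map euclidean euclidean (\<lambda>f :: 'a \<Rightarrow> complex. f y)"
    by (simp add: continuous_on_product_coordinates)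
  from continuous_map_pullback [OF this, of UNIV cblinfun_apply]
  show ?thesis by (simp add: weak_star_def comp_def)
qed

lemma continuous_map_into_weak_star:
  assumes "\<And>y. continuous_map X euclidean (\<lambda>t. cblinfun_apply (T t) y)"
  shows "continuous_map X weak_star T"
proof -
  have "continuous_map X (product_topology (\<lambda>_. euclidean) UNIV) (\<lambda>t. cblinfun_apply (T t))"
    using assms by (simp add: continuous_map_componentwise)
  then have "continuous_map X euclidean (\<lambda>t. cblinfun_apply (T t))"
    by (simp add: euclidean_product_topology)
  then show ?thesis
    unfolding weak_star_def by (intro continuous_map_pullback') (auto simp: comp_def)
qed

text \<open>The annihilator of a finite set has finite codimension, so a functional that vanishes on it is a
  combination of evaluations at points of the set.  In the induction step either the annihilator of
  \<open>S\<close> already annihilates \<open>s\<close>, or some \<open>\<psi>\<close> in it does not; in the latter case a multiple of the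
  evaluation at \<open>s\<close> is subtracted from \<open>\<Lambda>\<close> so that the difference vanishes at \<open>\<psi>\<close>.\<close>

lemma functional_vanishing_on_annihilator:
  fixes \<Lambda> :: "'a::complex_normed_vector cdual \<Rightarrow> complex"
  assumes "finite S" "clinear \<Lambda>"
    and "\<And>\<phi>. (\<And>y. y \<in> S \<Longrightarrow> cblinfun_apply \<phi> y = 0) \<Longrightarrow> \<Lambda> \<phi> = 0"
  shows "\<exists>y. \<forall>\<phi>. \<Lambda> \<phi> = cblinfun_apply \<phi> y"
  using assms
proof (induction S arbitrary: \<Lambda> rule: finite_induct)
  case empty
  then show ?case
    by (intro exI [of _ 0]) (simp add: cblinfun_linear_simps)
next
  case (insert s S)
  show ?case
  proof (cases "\<exists>\<psi> :: 'a cdual. (\<forall>y\<in>S. cblinfun_apply \<psi> y = 0) \<and> cblinfun_apply \<psi> s \<noteq> 0")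
    case False
    then have "\<Lambda> \<phi> = 0" if "\<And>y. y \<in> S \<Longrightarrow> cblinfun_apply \<phi> y = 0" for \<phi>
      using that insert.prems(2) [of \<phi>] by blast
    then show ?thesis
      using insert.IH [OF insert.prems(1)] by blast
  next
    case True
    then obtain \<psi> :: "'a cdual" where \<psi>: "\<And>y. y \<in> S \<Longrightarrow> cblinfun_apply \<psi> y = 0" "cblinfun_apply \<psi> s \<noteq> 0"
      by blast
    define c where "c = \<Lambda> \<psi> / cblinfun_apply \<psi> s"
    define \<Lambda>' where "\<Lambda>' \<phi> = \<Lambda> \<phi> - c * cblinfun_apply \<phi> s" for \<phi>
    have "clinear \<Lambda>'"
      using insert.prems(1)
      by (simp add: clinear_iff \<Lambda>'_def plus_cblinfun.rep_eq scaleC_cblinfun.rep_eq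
          scaleC_complex_def algebra_simps)
    moreover have "\<Lambda>' \<phi> = 0" if \<phi>: "\<And>y. y \<in> S \<Longrightarrow> cblinfun_apply \<phi> y = 0" for \<phi>
    proof -
      define a where "a = - cblinfun_apply \<phi> s / cblinfun_apply \<psi> s"
      have app: "cblinfun_apply (\<phi> + a *\<^sub>C \<psi>) y = cblinfun_apply \<phi> y + a * cblinfun_apply \<psi> y" for y
        by (simp add: plus_cblinfun.rep_eq scaleC_cblinfun.rep_eq scaleC_complex_def)
      have "\<Lambda> (\<phi> + a *\<^sub>C \<psi>) = 0"
      proof (rule insert.prems(2))
        show "cblinfun_apply (\<phi> + a *\<^sub>C \<psi>) y = 0" if "y \<in> insert s S" for y
          using that \<phi> \<psi> by (auto simp: app) (simp add: a_def)
      qed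
      then have "\<Lambda> \<phi> + a * \<Lambda> \<psi> = 0"
        using insert.prems(1) by (simp add: clinear_iff scaleC_complex_def)
      then show ?thesis
        using \<psi>(2) by (simp add: \<Lambda>'_def a_def c_def field_simps)
    qed
    ultimately obtain y where y: "\<And>\<phi>. \<Lambda>' \<phi> = cblinfun_apply \<phi> y"
      using insert.IH by blast
    have "\<Lambda> \<phi> = cblinfun_apply \<phi> (y + c *\<^sub>C s)" for \<phi>
      using y [of \<phi>] by (simp add: \<Lambda>'_def cblinfun_linear_simps scaleC_complex_def algebra_simps)
    then show ?thesis by blast
  qed
qed

text \<open>A weak* neighbourhood of \<open>0\<close> on which \<open>\<bar>\<Lambda>\<bar> < 1\<close> restricts only finitely many coordinates, so it
  contains the linear space of all functionals that vanish at these coordinates.  On this space \<open>\<Lambda>\<close>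
  is bounded, hence zero.\<close>

lemma weak_star_continuous_functional:
  fixes \<Lambda> :: "'a::complex_normed_vector cdual \<Rightarrow> complex"
  assumes lin: "clinear \<Lambda>" and cont: "continuous_map weak_star euclidean \<Lambda>"
  shows "\<exists>y. \<forall>\<phi>. \<Lambda> \<phi> = cblinfun_apply \<phi> y"
proof -
  have "\<Lambda> 0 = 0"
    using lin unfolding clinear_iff by (metis add_cancel_right_right)
  have "openin weak_star {\<phi> \<in> topspace weak_star. \<Lambda> \<phi> \<in> ball 0 1}"
    using cont by (rule openin_continuous_map_preimage) simp
  moreover have "topspace (weak_star :: 'a cdual topology) = UNIV"
    by (simp add: weak_star_def topspace_pullback_topology)
  ultimately obtain U where U: "open U" "\<And>\<phi>. cmod (\<Lambda> \<phi>) < 1 \<longleftrightarrow> cblinfun_apply \<phi> \<in> U"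
    by (auto simp: weak_star_def openin_pullback_topology)
  have "(\<lambda>_. 0) \<in> U"
    using U(2) [of 0] \<open>\<Lambda> 0 = 0\<close> by (simp add: zero_cblinfun.rep_eq)
  moreover have "openin (product_topology (\<lambda>_. euclidean) UNIV) U"
    using U(1) by (simp add: euclidean_product_topology)
  ultimately obtain X where X: "\<And>y :: 'a. (0 :: complex) \<in> X y" "finite {y. X y \<noteq> UNIV}" "Pi\<^sub>E UNIV X \<subseteq> U"
    using product_topology_open_contains_basis [of "\<lambda>_. euclidean" UNIV U "\<lambda>_. 0"]
    by (auto simp: PiE_UNIV_domain Pi_iff)
  show ?thesis
  proof (rule functional_vanishing_on_annihilator [OF X(2) lin])
    fix \<phi> :: "'a cdual" assume \<phi>: "\<And>y. y \<in> {y. X y \<noteq> UNIV} \<Longrightarrow> cblinfun_apply \<phi> y = 0"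
    \<comment> \<open>all multiples of \<open>\<phi>\<close> lie in the neighbourhood, so all multiples of \<open>\<Lambda> \<phi>\<close> lie in the unit disc\<close>
    have "cmod (\<Lambda> (a *\<^sub>C \<phi>)) < 1" for a
    proof -
      have "cblinfun_apply (a *\<^sub>C \<phi>) y \<in> X y" for y
        using X(1) [of y] \<phi> [of y]
        by (cases "X y = UNIV") (auto simp: scaleC_cblinfun.rep_eq scaleC_complex_def)
      then show ?thesis
        using X(3) by (auto simp: U(2) PiE_UNIV_domain)
    qed
    then have small: "cmod a * cmod (\<Lambda> \<phi>) < 1" for a
      using lin by (simp add: clinear_iff scaleC_complex_def norm_mult)
    show "\<Lambda> \<phi> = 0"
    proof (rule ccontr)
      assume "\<Lambda> \<phi> \<noteq> 0"
      then show False
        using small [of "inverse (\<Lambda> \<phi>)"] by (simp add: norm_inverse)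
    qed
  qed
qed

section \<open>Weakly holomorphic Lipschitz maps\<close>

text \<open>Write \<open>F z = z h(z)\<close> with \<open>h\<close> holomorphic and \<open>h(0) = F'(0)\<close>.  The bound on \<open>F\<close> says \<open>\<bar>h\<bar> \<le> M\<close>, so
  \<open>h - h(0)\<close> is bounded by \<open>2 M\<close> and vanishes at \<open>0\<close>; the Schwarz lemma bounds it by \<open>2 M \<bar>z\<bar> / R\<close>.\<close>

lemma holomorphic_first_order_remainder:
  assumes hol: "F holomorphic_on ball 0 R" and F: "\<And>z. cmod z < R \<Longrightarrow> cmod (F z) \<le> M * cmod z"
    and z: "cmod z < R"
  shows "cmod (F z - z * deriv F 0) \<le> 2 * M * (cmod z)\<^sup>2 / R"
proof -
  have R: "0 < R" using z by (rule le_less_trans [OF norm_ge_zero])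
  have "F 0 = 0" using F [of 0] R by simp
  obtain h where h: "h holomorphic_on ball 0 R" "\<And>w. cmod w < R \<Longrightarrow> F w = w * h w" "deriv F 0 = h 0"
    using Schwarz3 [OF hol \<open>F 0 = 0\<close>] by blast
  have h_le': "cmod (h w) \<le> M" if "w \<noteq> 0" "cmod w < R" for w
    using F [of w] h(2) [of w] that by (simp add: norm_mult mult.commute)
  have "cmod (h 0) \<le> M"
  proof (rule tendsto_upperbound)
    have "isCont h 0"
      using holomorphic_on_imp_continuous_on [OF h(1)] R by (simp add: continuous_on_eq_continuous_at)
    then show "((\<lambda>w. cmod (h w)) \<longlongrightarrow> cmod (h 0)) (at 0)"
      by (intro tendsto_norm) (simp add: isCont_def)
    show "eventually (\<lambda>w. cmod (h w) \<le> M) (at 0)"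
      unfolding eventually_at using R h_le' by (intro exI [of _ R]) (auto simp: dist_norm)
  qed simp
  then have h_le: "cmod (h w) \<le> M" if "cmod w < R" for w
    using h_le' [of w] that by (cases "w = 0") auto
  have "0 \<le> M" using \<open>cmod (h 0) \<le> M\<close> norm_ge_zero order_trans by blast
  have "cmod (h z - h 0) \<le> 2 * M * (cmod z / R)"
  proof (rule field_le_epsilon)
    fix e :: real assume "0 < e"
    \<comment> \<open>slightly more than the bound, because the Schwarz lemma asks for values strictly inside the disc\<close>
    define N where "N = 2 * M + e"
    have N: "0 < N" "2 * M < N" using \<open>0 \<le> M\<close> \<open>0 < e\<close> by (auto simp: N_def)
    define k where "k w = (h (of_real R * w) - h 0) / of_real N" for w
    have in_ball: "cmod (of_real R * w) < R" if "cmod w < 1" for w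
      using that R by (simp add: norm_mult)
    have "h \<circ> (\<lambda>w. of_real R * w) holomorphic_on ball 0 1"
      by (rule holomorphic_on_compose_gen [OF _ h(1)]) (auto intro!: holomorphic_intros in_ball)
    then have "k holomorphic_on ball 0 1"
      unfolding k_def comp_def by (intro holomorphic_intros) (use N in auto)
    moreover have "k 0 = 0" by (simp add: k_def)
    moreover have "cmod (k w) < 1" if "cmod w < 1" for w
      using norm_triangle_ineq4 [of "h (of_real R * w)" "h 0"] h_le [OF in_ball [OF that]] h_le [of 0] R N
      by (simp add: k_def norm_divide)
    moreover have "cmod (z / of_real R) < 1" using z R by (simp add: norm_divide)
    ultimately have "cmod (k (z / of_real R)) \<le> cmod (z / of_real R)"
      by (rule Schwarz_Lemma(1))
    then have "cmod (h z - h 0) \<le> N * (cmod z / R)"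
      using R N by (simp add: k_def norm_divide field_simps)
    also have "\<dots> = 2 * M * (cmod z / R) + e * (cmod z / R)"
      by (simp add: N_def algebra_simps add_divide_distrib)
    also have "\<dots> \<le> 2 * M * (cmod z / R) + e"
      using mult_left_le [of "cmod z / R" e] z R \<open>0 < e\<close> by simp
    finally show "cmod (h z - h 0) \<le> 2 * M * (cmod z / R) + e" .
  qed
  then have "cmod z * cmod (h z - h 0) \<le> cmod z * (2 * M * (cmod z / R))"
    by (rule mult_left_mono) simp
  moreover have "F z - z * deriv F 0 = z * (h z - h 0)"
    using h(2) [OF z] h(3) by (simp add: algebra_simps)
  ultimately show ?thesis
    by (simp add: norm_mult power2_eq_square mult_ac)
qed

text \<open>The one variable estimate on the disc of radius \<open>(1 - \<parallel>x\<parallel>) / \<parallel>h\<parallel>\<close>, for the restriction of \<open>g\<close> to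
  the complex line through \<open>x\<close> in direction \<open>h\<close>.  The bound depends on \<open>g\<close> only through its Lipschitz
  constant, which gives the uniformity in the vector valued case.\<close>

lemma holomorphic_lipschitz_remainder:
  fixes g :: "'a::complex_normed_vector \<Rightarrow> complex"
  assumes hol: "holomorphic_map_on g (ball 0 1)" and lip: "L-lipschitz_on (ball 0 1) g"
    and x: "norm x + norm h < 1"
    and D: "bounded_clinear D" "(g has_derivative D) (at x)"
  shows "cmod (g (x + h) - g x - D h) \<le> 2 * L * (norm h)\<^sup>2 / (1 - norm x)"
proof (cases "h = 0")
  case True
  then show ?thesis
    using bounded_clinear_scale_app [OF D(1), of 0 0] by (simp add: scaleC_complex_def)
next
  case False
  define R where "R = (1 - norm x) / norm h"
  have R: "1 < R" using x False by (simp add: R_def)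
  define F where "F \<zeta> = g (x + \<zeta> *\<^sub>C h) - g x" for \<zeta>
  have in_ball: "x + \<zeta> *\<^sub>C h \<in> ball 0 1" if "cmod \<zeta> < R" for \<zeta>
  proof -
    have "norm (x + \<zeta> *\<^sub>C h) \<le> norm x + cmod \<zeta> * norm h"
      using norm_triangle_ineq [of x "\<zeta> *\<^sub>C h"] by (simp add: norm_scaleC)
    also have "\<dots> < 1" using that False by (simp add: R_def field_simps)
    finally show ?thesis by simp
  qed
  have x_ball: "x \<in> ball 0 1" using in_ball [of 0] R by simp
  have F_deriv: "(F has_field_derivative E h) (at \<zeta>)"
    if "bounded_clinear E" "(g has_derivative E) (at (x + \<zeta> *\<^sub>C h))" for E \<zeta>
  proof -
    have "bounded_linear (\<lambda>\<zeta>. \<zeta> *\<^sub>C h)"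
      by (rule bounded_linear_intro [where K = "norm h"])
        (simp_all add: scaleC_add_left scaleR_scaleC scaleC_scaleC scaleC_complex_def norm_scaleC scaleR_conv_of_real)
    then have "((\<lambda>\<zeta>. x + \<zeta> *\<^sub>C h) has_derivative (\<lambda>\<zeta>. \<zeta> *\<^sub>C h)) (at \<zeta>)"
      by (auto intro!: derivative_eq_intros bounded_linear_imp_has_derivative)
    then have "((\<lambda>\<zeta>. g (x + \<zeta> *\<^sub>C h)) has_derivative (\<lambda>\<zeta>. E (\<zeta> *\<^sub>C h))) (at \<zeta>)"
      using that(2) by (rule has_derivative_compose)
    then have "(F has_derivative (\<lambda>\<zeta>. E (\<zeta> *\<^sub>C h))) (at \<zeta>)"
      unfolding F_def by (auto intro!: derivative_eq_intros)
    moreover have "(\<lambda>\<zeta>. E (\<zeta> *\<^sub>C h)) = (*) (E h)"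
      by (simp add: bounded_clinear_scale_app [OF that(1)] scaleC_complex_def fun_eq_iff)
    ultimately show ?thesis by (simp add: has_field_derivative_def)
  qed
  have "F holomorphic_on ball 0 R"
  proof (rule holomorphic_onI)
    fix \<zeta> :: complex assume "\<zeta> \<in> ball 0 R"
    then have b: "x + \<zeta> *\<^sub>C h \<in> ball 0 1" using in_ball by simp
    then obtain E where "bounded_clinear E" "(g has_derivative E) (at (x + \<zeta> *\<^sub>C h) within ball 0 1)"
      using hol unfolding holomorphic_map_on_def by blast
    then have "(F has_field_derivative E h) (at \<zeta>)"
      using b by (intro F_deriv) (auto simp: at_within_open [OF _ open_ball])
    then show "F field_differentiable at \<zeta> within ball 0 R"
      by (meson field_differentiable_at_within field_differentiable_def)
  qed
  moreover have "cmod (F \<zeta>) \<le> (L * norm h) * cmod \<zeta>" if "cmod \<zeta> < R" for \<zeta>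
    using lipschitz_onD [OF lip in_ball [OF that] x_ball]
    by (simp add: F_def dist_norm norm_scaleC mult_ac)
  moreover have "cmod 1 < R" using R by simp
  ultimately have "cmod (F 1 - 1 * deriv F 0) \<le> 2 * (L * norm h) * (cmod 1)\<^sup>2 / R"
    by (rule holomorphic_first_order_remainder)
  moreover have "deriv F 0 = D h"
    by (rule DERIV_imp_deriv, rule F_deriv) (use D in simp_all)
  ultimately show ?thesis
    by (simp add: F_def R_def power2_eq_square mult_ac)
qed

text \<open>Dunford's theorem in the Lipschitz case.  The remainder estimate, applied to \<open>\<phi> \<circ> f\<close>, shows that the
  difference quotients of \<open>f\<close> at \<open>x\<close> in a direction \<open>h\<close>, viewed as functionals of \<open>\<phi>\<close>, converge
  uniformly on the dual unit ball; their limit is a vector, and these vectors form the derivative.\<close>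

lemma weakly_holomorphic_lipschitz_imp_holomorphic:
  fixes f :: "'a::complex_normed_vector \<Rightarrow> 'b::complex_banach"
  assumes lip: "K-lipschitz_on (ball 0 1) f"
    and weak: "\<And>\<phi> :: 'b cdual. holomorphic_map_on (\<lambda>x. cblinfun_apply \<phi> (f x)) (ball 0 1)"
  shows "holomorphic_map_on f (ball 0 1)"
  unfolding holomorphic_map_on_def
proof
  fix x :: 'a assume x: "x \<in> ball 0 1"
  have K: "0 \<le> K" by (rule lipschitz_on_nonneg [OF lip])
  define r where "r = 1 - norm x"
  define C where "C = 2 * K / r"
  have r: "0 < r" using x by (simp add: r_def)
  have C: "0 \<le> C" using r K by (simp add: C_def)
  have "\<forall>\<phi> :: 'b cdual. \<exists>D. bounded_clinear D \<and> ((\<lambda>x. cblinfun_apply \<phi> (f x)) has_derivative D) (at x)"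
    using weak x unfolding holomorphic_map_on_def by (auto simp: at_within_open [OF _ open_ball])
  then obtain D :: "'b cdual \<Rightarrow> 'a \<Rightarrow> complex" where D: "\<And>\<phi>. bounded_clinear (D \<phi>)"
    "\<And>\<phi>. ((\<lambda>x. cblinfun_apply \<phi> (f x)) has_derivative D \<phi>) (at x)"
    by metis
  have rem: "cmod (cblinfun_apply \<phi> (f (x + h) - f x) - D \<phi> h) \<le> C * (norm h)\<^sup>2 * norm \<phi>"
    if h: "norm h < r" for \<phi> h
  proof -
    have "(norm \<phi> * K)-lipschitz_on (ball 0 1) (\<lambda>x. cblinfun_apply \<phi> (f x))"
    proof (rule lipschitz_onI)
      fix u v :: 'a assume uv: "u \<in> ball 0 1" "v \<in> ball 0 1"
      have "cmod (cblinfun_apply \<phi> (f u - f v)) \<le> norm \<phi> * norm (f u - f v)"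
        by (rule norm_cblinfun_apply)
      also have "\<dots> \<le> norm \<phi> * (K * dist u v)"
        using lipschitz_onD [OF lip uv] by (intro mult_left_mono) (simp_all add: dist_norm)
      finally show "dist (cblinfun_apply \<phi> (f u)) (cblinfun_apply \<phi> (f v)) \<le> norm \<phi> * K * dist u v"
        by (simp add: dist_norm cblinfun_linear_simps mult.assoc)
    qed (simp add: K)
    from holomorphic_lipschitz_remainder [OF weak this _ D(1) D(2), of h] h
    show ?thesis by (simp add: r_def C_def cblinfun_linear_simps mult_ac)
  qed
  have "\<exists>l. norm l \<le> K * norm h \<and> (\<forall>\<phi>. cblinfun_apply \<phi> l = D \<phi> h)" for h
  proof -
    \<comment> \<open>step sizes tending to \<open>0\<close> that keep \<open>x + t n h\<close> in the ball from the first one on\<close>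
    define t where "t n = r / (norm h + 1) * inverse (real (Suc n))" for n
    have t: "0 < t n" "t n * norm h < r" for n
    proof -
      have "0 < norm h + 1" by (simp add: add_nonneg_pos)
      then show "0 < t n" using r by (simp add: t_def)
      have "t n \<le> r / (norm h + 1)"
        unfolding t_def using r \<open>0 < norm h + 1\<close> by (intro mult_right_le_one_le) (auto simp: inverse_le_1_iff)
      then have "t n * norm h \<le> r / (norm h + 1) * norm h"
        by (rule mult_right_mono) simp
      also have "\<dots> < r" using r \<open>0 < norm h + 1\<close> by (simp add: field_simps)
      finally show "t n * norm h < r" .
    qed
    have in_ball: "x + t n *\<^sub>R h \<in> ball 0 1" for n
      using norm_triangle_ineq [of x "t n *\<^sub>R h"] t [of n] by (simp add: r_def)
    define y where "y n = inverse (t n) *\<^sub>R (f (x + t n *\<^sub>R h) - f x)" for n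
    have "cmod (cblinfun_apply \<phi> (y n) - D \<phi> h) \<le> (C * (norm h)\<^sup>2 * t n) * norm \<phi>" for n \<phi>
    proof -
      have "D \<phi> (t n *\<^sub>R h) = t n *\<^sub>R D \<phi> h"
        using D(1) by (simp add: bounded_clinear_def linear_scale bounded_linear.linear)
      then have "cblinfun_apply \<phi> (y n) - D \<phi> h =
          inverse (t n) *\<^sub>R (cblinfun_apply \<phi> (f (x + t n *\<^sub>R h) - f x) - D \<phi> (t n *\<^sub>R h))"
        using t(1) [of n] by (simp add: y_def cblinfun_scaleR cblinfun_linear_simps algebra_simps)
      also have "cmod \<dots> \<le> inverse (t n) * (C * (norm (t n *\<^sub>R h))\<^sup>2 * norm \<phi>)"
        using t [of n] rem [of "t n *\<^sub>R h" \<phi>] by (simp add: mult_left_mono)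
      also have "\<dots> = (C * (norm h)\<^sup>2 * t n) * norm \<phi>"
        using t(1) [of n] by (simp add: power2_eq_square field_simps)
      finally show ?thesis .
    qed
    moreover have "(\<lambda>n. C * (norm h)\<^sup>2 * t n) \<longlonglongrightarrow> 0"
      unfolding t_def by (intro tendsto_mult_right_zero LIMSEQ_inverse_real_of_nat)
    ultimately obtain l where l: "y \<longlonglongrightarrow> l" "\<And>\<phi>. cblinfun_apply \<phi> l = D \<phi> h"
      by (rule evaluation_closed_in_bidual) blast
    have "norm (y n) \<le> K * norm h" for n
    proof -
      have "norm (y n) = norm (f (x + t n *\<^sub>R h) - f x) / t n"
        using t(1) [of n] by (simp add: y_def divide_inverse_commute)
      then show ?thesis
        using lipschitz_onD [OF lip in_ball x, of n] t(1) [of n]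
        by (simp add: dist_norm divide_le_eq mult_ac)
    qed
    then have "norm l \<le> K * norm h"
      by (intro LIMSEQ_le_const2 [OF tendsto_norm [OF l(1)]]) blast
    with l(2) show ?thesis by blast
  qed
  then obtain Df where Df: "\<And>h. norm (Df h) \<le> K * norm h" "\<And>h \<phi>. cblinfun_apply \<phi> (Df h) = D \<phi> h"
    by metis
  have bc: "bounded_clinear Df"
  proof (rule bounded_clinearI)
    show "Df (u + v) = Df u + Df v" for u v
      by (rule dual_separates)
        (simp add: Df(2) cblinfun_linear_simps bounded_clinear_add_app [OF D(1)])
    show "Df (a *\<^sub>C u) = a *\<^sub>C Df u" for a u
      by (rule dual_separates)
        (simp add: Df(2) cblinfun_linear_simps bounded_clinear_scale_app [OF D(1)])
    show "norm (Df u) \<le> norm u * K" for u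
      using Df(1) [of u] by (simp add: mult.commute)
  qed
  have "(f has_derivative Df) (at x within ball 0 1)"
  proof (rule has_derivativeI_sandwich [where e = r and H = "\<lambda>y. C * norm (y - x)"])
    show "bounded_linear Df" using bc by (simp add: bounded_clinear_def)
    show "((\<lambda>y. C * norm (y - x)) \<longlongrightarrow> 0) (at x within ball 0 1)"
      by (auto intro!: tendsto_eq_intros)
    fix y assume y: "y \<noteq> x" "dist y x < r"
    have "norm (f y - f x - Df (y - x)) \<le> C * (norm (y - x))\<^sup>2"
    proof (rule norm_le_dual)
      show "cmod (cblinfun_apply \<phi> (f y - f x - Df (y - x))) \<le> C * (norm (y - x))\<^sup>2 * norm \<phi>" for \<phi>
        using rem [of "y - x" \<phi>] y(2) by (simp add: dist_norm cblinfun_linear_simps Df(2))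
    qed (simp add: C)
    then show "norm (f y - f x - Df (y - x)) / norm (y - x) \<le> C * norm (y - x)"
      using y(1) by (simp add: divide_le_eq power2_eq_square mult.assoc)
  qed (rule r)
  with bc show "\<exists>D. bounded_clinear D \<and> (f has_derivative D) (at x within ball 0 1)"
    by blast
qed

section \<open>The transpose as an isometry\<close>

lemma HL0_transpose_apply [simp]:
  "HL0_apply (HL0_transpose f \<phi>) x = cblinfun_apply \<phi> (HL0_apply f x)"
  by (simp add: HL0_transpose.rep_eq)

lemma HL0_eqI: "(\<And>x. HL0_apply f x = HL0_apply g x) \<Longrightarrow> f = g"
  by (simp add: HL0_apply_inject [symmetric] fun_eq_iff)

lemma norm_HL0_transpose_le:
  fixes f :: "('a::complex_normed_vector, 'b::complex_normed_vector) HL0"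
  shows "norm (HL0_transpose f \<phi>) \<le> norm f * norm \<phi>"
  unfolding norm_HL0.rep_eq [of "HL0_transpose f \<phi>"]
proof (rule lip_norm_le)
  fix x y :: 'a assume xy: "x \<in> ball 0 1" "y \<in> ball 0 1"
  have "cmod (cblinfun_apply \<phi> (HL0_apply f x - HL0_apply f y)) \<le>
      norm \<phi> * norm (HL0_apply f x - HL0_apply f y)"
    by (rule norm_cblinfun_apply)
  also have "\<dots> \<le> norm \<phi> * (norm f * norm (x - y))"
    unfolding norm_HL0.rep_eq by (intro mult_left_mono lip_norm_bound [OF HL0_apply xy]) simp
  finally show "norm (HL0_apply (HL0_transpose f \<phi>) x - HL0_apply (HL0_transpose f \<phi>) y)
      \<le> norm f * norm \<phi> * norm (x - y)"
    by (simp add: cblinfun_linear_simps mult_ac)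
qed simp

lemma bounded_clinear_HL0_transpose: "bounded_clinear (HL0_transpose f)"
proof (rule bounded_clinearI)
  show "HL0_transpose f (\<phi> + \<psi>) = HL0_transpose f \<phi> + HL0_transpose f \<psi>" for \<phi> \<psi>
    by (rule HL0_eqI) (simp add: plus_HL0.rep_eq plus_cblinfun.rep_eq)
  show "HL0_transpose f (a *\<^sub>C \<phi>) = a *\<^sub>C HL0_transpose f \<phi>" for a \<phi>
    by (rule HL0_eqI) (simp add: scaleC_HL0.rep_eq scaleC_cblinfun.rep_eq)
  show "norm (HL0_transpose f \<phi>) \<le> norm \<phi> * norm f" for \<phi>
    using norm_HL0_transpose_le [of f \<phi>] by (simp add: mult.commute)
qed

lemma onorm_HL0_transpose:
  fixes f :: "('a::complex_normed_vector, 'b::complex_normed_vector) HL0"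
  shows "onorm (HL0_transpose f) = norm f"
proof (rule antisym)
  have bl: "bounded_linear (HL0_transpose f)"
    using bounded_clinear_HL0_transpose [of f] by (simp add: bounded_clinear_def)
  show "onorm (HL0_transpose f) \<le> norm f"
    by (rule onorm_bound [OF norm_ge_zero norm_HL0_transpose_le])
  show "norm f \<le> onorm (HL0_transpose f)"
    unfolding norm_HL0.rep_eq
  proof (rule lip_norm_le)
    fix x y :: 'a assume xy: "x \<in> ball 0 1" "y \<in> ball 0 1"
    show "norm (HL0_apply f x - HL0_apply f y) \<le> onorm (HL0_transpose f) * norm (x - y)"
    proof (rule norm_le_dual)
      fix \<phi> :: "'b cdual"
      have "cmod (cblinfun_apply \<phi> (HL0_apply f x - HL0_apply f y)) \<le>
          norm (HL0_transpose f \<phi>) * norm (x - y)"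
        using lip_norm_bound [OF HL0_apply xy, of "HL0_transpose f \<phi>"]
        by (simp add: norm_HL0.rep_eq cblinfun_linear_simps)
      also have "\<dots> \<le> (onorm (HL0_transpose f) * norm \<phi>) * norm (x - y)"
        by (intro mult_right_mono onorm [OF bl]) simp
      finally show "cmod (cblinfun_apply \<phi> (HL0_apply f x - HL0_apply f y)) \<le>
          onorm (HL0_transpose f) * norm (x - y) * norm \<phi>"
        by (simp add: mult_ac)
    qed (simp add: onorm_pos_le [OF bl])
  qed (rule onorm_pos_le [OF bl])
qed

lemma inj_HL0_transpose: "inj HL0_transpose"
proof (rule injI, rule HL0_eqI, rule dual_separates)
  fix f g :: "('a, 'b) HL0" and x and \<phi> :: "'b cdual"
  assume "HL0_transpose f = HL0_transpose g"
  then have "HL0_apply (HL0_transpose f \<phi>) x = HL0_apply (HL0_transpose g \<phi>) x" by simp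
  then show "cblinfun_apply \<phi> (HL0_apply f x) = cblinfun_apply \<phi> (HL0_apply g x)" by simp
qed

section \<open>Weak* continuity of the transpose and the converse\<close>

lemma continuous_map_into_HL0_weak_star:
  assumes "\<And>\<gamma>. continuous_map X euclidean (\<lambda>t. cblinfun_apply (G0_Rep \<gamma>) (T t))"
  shows "continuous_map X HL0_weak_star T"
  unfolding HL0_weak_star_def
proof (rule continuous_map_pullback')
  show "continuous_map X weak_star (HL0_Lambda \<circ> T)"
    by (rule continuous_map_into_weak_star)
      (simp add: HL0_Lambda_def linearization_scalar G0_eval.rep_eq assms)
qed simp

lemma continuous_map_HL0_weak_star_eval:
  assumes "x \<in> ball 0 1"
  shows "continuous_map HL0_weak_star euclidean (\<lambda>g. HL0_apply g x)"
proof -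
  have "continuous_map HL0_weak_star euclidean
      ((\<lambda>\<psi>. cblinfun_apply \<psi> (G0_delta x)) \<circ> HL0_Lambda)"
    unfolding HL0_weak_star_def
    by (rule continuous_map_pullback [OF continuous_map_weak_star_apply])
  then show ?thesis
    using assms by (simp add: comp_def HL0_Lambda_def linearization_scalar G0_eval_delta)
qed

text \<open>The vector is \<open>T\<^sub>f \<gamma>\<close> for the linearization \<open>T\<^sub>f\<close> of \<open>f\<close>: a combination of values of \<open>f\<close> if
  \<open>\<gamma>\<close> is in the span of \<open>\<delta>\<close>, and a limit of such combinations in general.\<close>

lemma G0_transpose_evaluation:
  fixes f :: "('a::complex_normed_vector, 'b::complex_banach) HL0"
  shows "\<exists>y. \<forall>\<phi>. cblinfun_apply (G0_Rep \<gamma>) (HL0_transpose f \<phi>) = cblinfun_apply \<phi> y"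
proof -
  have span: "\<exists>y. \<forall>\<phi>. cblinfun_apply \<mu> (HL0_transpose f \<phi>) = cblinfun_apply \<phi> y"
    if "\<mu> \<in> complex_vector.span (HL0_delta ` ball 0 1)" for \<mu>
    using that
  proof (induction rule: complex_vector.span_induct_alt)
    case base
    show ?case
      by (intro exI [of _ 0]) (simp add: zero_cblinfun.rep_eq cblinfun_linear_simps)
  next
    case (step c \<nu> \<mu>)
    obtain x where x: "\<nu> = HL0_delta x" using step by blast
    obtain y where "\<forall>\<phi>. cblinfun_apply \<mu> (HL0_transpose f \<phi>) = cblinfun_apply \<phi> y"
      using step by blast
    then show ?case
      by (intro exI [of _ "c *\<^sub>C HL0_apply f x + y"])
        (simp add: x plus_cblinfun.rep_eq scaleC_cblinfun.rep_eq HL0_delta.rep_eq cblinfun_linear_simps)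
  qed
  obtain X where X: "\<And>n. X n \<in> complex_vector.span (HL0_delta ` ball 0 1)" "X \<longlonglongrightarrow> G0_Rep \<gamma>"
    using G0_Rep [of \<gamma>] unfolding G0_set_def closure_sequential by blast
  obtain y where y: "\<And>n \<phi>. cblinfun_apply (X n) (HL0_transpose f \<phi>) = cblinfun_apply \<phi> (y n)"
    using span [OF X(1)] by metis
  have "cmod (cblinfun_apply \<phi> (y n) - cblinfun_apply (G0_Rep \<gamma>) (HL0_transpose f \<phi>))
      \<le> (norm (X n - G0_Rep \<gamma>) * norm f) * norm \<phi>" for n \<phi>
  proof -
    have "cmod (cblinfun_apply (X n - G0_Rep \<gamma>) (HL0_transpose f \<phi>)) \<le>
        norm (X n - G0_Rep \<gamma>) * norm (HL0_transpose f \<phi>)"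
      by (rule norm_cblinfun_apply)
    also have "\<dots> \<le> norm (X n - G0_Rep \<gamma>) * (norm f * norm \<phi>)"
      by (intro mult_left_mono norm_HL0_transpose_le) simp
    finally show ?thesis by (simp add: minus_cblinfun.rep_eq y mult.assoc)
  qed
  moreover have "(\<lambda>n. norm (X n - G0_Rep \<gamma>) * norm f) \<longlonglongrightarrow> 0"
    using X(2) by (intro tendsto_mult_left_zero) (simp add: LIM_zero_iff tendsto_norm_zero)
  ultimately obtain l where "\<And>\<phi>. cblinfun_apply \<phi> l = cblinfun_apply (G0_Rep \<gamma>) (HL0_transpose f \<phi>)"
    by (rule evaluation_closed_in_bidual) blast
  then show ?thesis by metis
qed

lemma HL0_transpose_in_weak_star_operators:
  fixes f :: "('a::complex_normed_vector, 'b::complex_banach) HL0"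
  shows "HL0_transpose f \<in> weak_star_operators"
proof -
  have "continuous_map weak_star HL0_weak_star (HL0_transpose f)"
  proof (rule continuous_map_into_HL0_weak_star)
    fix \<gamma> :: "'a G0"
    obtain y where "\<And>\<phi>. cblinfun_apply (G0_Rep \<gamma>) (HL0_transpose f \<phi>) = cblinfun_apply \<phi> y"
      using G0_transpose_evaluation by blast
    then show "continuous_map weak_star euclidean (\<lambda>\<phi>. cblinfun_apply (G0_Rep \<gamma>) (HL0_transpose f \<phi>))"
      by (simp add: continuous_map_weak_star_apply)
  qed
  then show ?thesis
    using bounded_clinear_HL0_transpose [of f]
    by (simp add: weak_star_operators_def bounded_clinear_def)
qed

text \<open>Weak* continuity represents \<open>\<phi> \<mapsto> T \<phi> x\<close> by a vector \<open>f x\<close>.  The single bound \<open>\<parallel>T \<phi>\<parallel>\<close> for all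
  difference quotients of \<open>\<phi> \<circ> f\<close> makes the set of difference quotients of \<open>f\<close> weakly bounded.\<close>

lemma weak_star_operator_is_transpose:
  fixes T :: "'b::complex_banach cdual \<Rightarrow> ('a::complex_normed_vector, complex) HL0"
  assumes "T \<in> weak_star_operators"
  obtains f :: "('a, 'b) HL0" where "HL0_transpose f = T"
proof -
  have lin: "clinear T" and cont: "continuous_map weak_star HL0_weak_star T"
    using assms by (simp_all add: weak_star_operators_def)
  have "\<exists>y. \<forall>\<phi>. cblinfun_apply \<phi> y = HL0_apply (T \<phi>) x" for x
  proof (cases "x \<in> ball 0 1")
    case True
    have "clinear (\<lambda>\<phi>. HL0_apply (T \<phi>) x)"
      using lin by (simp add: clinear_iff plus_HL0.rep_eq scaleC_HL0.rep_eq)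
    moreover have "continuous_map weak_star euclidean (\<lambda>\<phi>. HL0_apply (T \<phi>) x)"
      using continuous_map_compose [OF cont continuous_map_HL0_weak_star_eval [OF True]]
      by (simp add: comp_def)
    ultimately show ?thesis
      using weak_star_continuous_functional by metis
  next
    case False
    have "HL0_apply (T \<phi>) x = 0" for \<phi>
      by (rule HL0_setD(3) [OF HL0_apply False])
    then show ?thesis
      by (intro exI [of _ 0]) (simp add: cblinfun_linear_simps)
  qed
  then obtain f where f: "\<And>x \<phi>. cblinfun_apply \<phi> (f x) = HL0_apply (T \<phi>) x"
    by metis
  \<comment> \<open>a pair \<open>x = y\<close> contributes the vector \<open>0\<close>, as the inverse of \<open>0\<close> is \<open>0\<close>\<close>
  define Q where "Q = {(f x - f y) /\<^sub>R norm (x - y) | x y. x \<in> ball 0 1 \<and> y \<in> ball 0 1}"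
  have "bounded Q"
  proof (rule weakly_bounded_imp_bounded_complex)
    fix \<phi> :: "'b cdual"
    have "cmod (cblinfun_apply \<phi> ((f x - f y) /\<^sub>R norm (x - y))) \<le> norm (T \<phi>)"
      if "x \<in> ball 0 1" "y \<in> ball 0 1" for x y
    proof -
      have "cmod (cblinfun_apply \<phi> ((f x - f y) /\<^sub>R norm (x - y))) =
          cmod (HL0_apply (T \<phi>) x - HL0_apply (T \<phi>) y) / norm (x - y)"
        by (simp only: cblinfun_scaleR cblinfun_linear_simps f) (simp add: divide_inverse_commute)
      also have "\<dots> \<le> norm (T \<phi>)"
        using lip_norm_bound [OF HL0_apply that, of "T \<phi>"]
        by (cases "x = y") (simp_all add: norm_HL0.rep_eq [symmetric] divide_le_eq)
      finally show ?thesis .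
    qed
    then show "\<exists>C. \<forall>q\<in>Q. cmod (cblinfun_apply \<phi> q) \<le> C"
      unfolding Q_def by blast
  qed
  then obtain K where K: "0 < K" "\<And>q. q \<in> Q \<Longrightarrow> norm q \<le> K"
    by (auto simp: bounded_pos)
  have lip: "K-lipschitz_on (ball 0 1) f"
  proof (rule lipschitz_onI)
    fix x y :: 'a assume "x \<in> ball 0 1" "y \<in> ball 0 1"
    then have "norm ((f x - f y) /\<^sub>R norm (x - y)) \<le> K"
      by (intro K(2)) (auto simp: Q_def)
    then show "dist (f x) (f y) \<le> K * dist x y"
      by (cases "x = y") (simp_all add: dist_norm divide_inverse_commute [symmetric] divide_le_eq)
  qed (use K in simp)
  have "f \<in> HL0_set"
  proof (rule HL0_setI [OF _ lip])
    show "holomorphic_map_on f (ball 0 1)"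
      by (rule weakly_holomorphic_lipschitz_imp_holomorphic [OF lip])
        (simp add: f HL0_setD(1) [OF HL0_apply])
    show "f 0 = 0"
      by (rule dual_separates) (simp add: f HL0_setD(2) [OF HL0_apply] cblinfun_linear_simps)
    show "f x = 0" if "x \<notin> ball 0 1" for x
      by (rule dual_separates) (simp only: f HL0_setD(3) [OF HL0_apply that] cblinfun_linear_simps)
  qed
  then have "HL0_apply (HL0_Abs f) = f" by (rule HL0_Abs_inverse)
  then have "HL0_transpose (HL0_Abs f) = T"
    by (intro ext HL0_eqI) (simp add: f)
  then show thesis by (rule that)
qed

theorem corollary1p11:
  shows "(\<forall>f g :: ('x::complex_banach, 'y::complex_banach) HL0.
      HL0_transpose (f + g) = (\<lambda>\<phi>. HL0_transpose f \<phi> + HL0_transpose g \<phi>)) \<and>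
    (\<forall>a (f :: ('x, 'y) HL0). HL0_transpose (a *\<^sub>C f) = (\<lambda>\<phi>. a *\<^sub>C HL0_transpose f \<phi>)) \<and>
    bij_betw HL0_transpose (UNIV :: ('x, 'y) HL0 set) weak_star_operators \<and>
    (\<forall>f :: ('x, 'y) HL0.
      bounded_clinear (HL0_transpose f) \<and> onorm (HL0_transpose f) = norm f)"
proof (intro conjI allI)
  fix f g :: "('x, 'y) HL0" and a :: complex
  show "HL0_transpose (f + g) = (\<lambda>\<phi>. HL0_transpose f \<phi> + HL0_transpose g \<phi>)"
    by (intro ext HL0_eqI) (simp add: plus_HL0.rep_eq cblinfun_linear_simps)
  show "HL0_transpose (a *\<^sub>C f) = (\<lambda>\<phi>. a *\<^sub>C HL0_transpose f \<phi>)"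
    by (intro ext HL0_eqI) (simp add: scaleC_HL0.rep_eq cblinfun_linear_simps)
  show "bounded_clinear (HL0_transpose f)" "onorm (HL0_transpose f) = norm f"
    by (fact bounded_clinear_HL0_transpose onorm_HL0_transpose)+
next
  show "bij_betw HL0_transpose (UNIV :: ('x, 'y) HL0 set) weak_star_operators"
    unfolding bij_betw_def
  proof (intro conjI inj_HL0_transpose set_eqI iffI)
    fix T :: "'y cdual \<Rightarrow> ('x, complex) HL0"
    show "T \<in> weak_star_operators" if "T \<in> range HL0_transpose"
      using that HL0_transpose_in_weak_star_operators by blast
    show "T \<in> range HL0_transpose" if "T \<in> weak_star_operators"
      using weak_star_operator_is_transpose [OF that] by blast
  qed
qed

end
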